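(* Let $\mathfrak{A}$ be a $C^*$-algebra, $\mathcal{H}$ a Hilbert space, $k\in\mathbb{N}$, and let $T:\mathfrak{A}\to\mathcal{B}(\mathcal{H})$ be a bounded linear map. Then $T$ is $k$-positive if and only if $$\sum_{p=1}^{p_0}\sum_{i,j=1}^k \mathrm{Tr}\big(T(a^p_{ij})\,(\varrho^{p}_{ij})^t\big)\ge 0$$ for every $p_0\in\mathbb{N}$ and all $[a^p_{ij}]_{i,j=1}^k\in M_k(\mathfrak{A})^+$ and $[\varrho^p_{ij}]_{i,j=1}^k\in M_k(\mathcal{B}(\mathcal{H})_* )^+$, $p=1,\dots,p_0$.
   Context: $\mathcal{B}(\mathcal{H})_*$ is the predual of $\mathcal{B}(\mathcal{H})$, identified with the trace class operators on $\mathcal{H}$. $M_k(\mathcal{B}(\mathcal{H})_* )^+$ is the set of $k\times k$ matrices $[\varrho_{ij}]$ of trace class operators that are positive as operators on $\mathbb{C}^k\otimes\mathcal{H}$. $x\mapsto x^t$ is the transpose map on $\mathcal{B}(\mathcal{H})$ with respect to a fixed orthonormal basis. $T$ is $k$-positive if $T_k=\mathrm{id}_{M_k}\otimes T: M_k(\mathbb{C})\otimes\mathfrak{A}\to M_k(\mathbb{C})\otimes\mathcal{B}(\mathcal{H})$, i.e. $[a_{ij}]\mapsto[T(a_{ij})]$, is a positive map. *)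

theory Defs
  imports "HOL-Analysis.Analysis" "HOL-Library.Complex_Order"
begin

section \<open>Complex Banach spaces and \<open>C\<^sup>*\<close>-algebras\<close>

class complex_normed_vector = real_normed_vector +
  fixes scaleC :: "complex \<Rightarrow> 'a \<Rightarrow> 'a"  (infixr "*\<^sub>C" 75)
  assumes scaleC_add_right: "c *\<^sub>C (x + y) = c *\<^sub>C x + c *\<^sub>C y"
    and scaleC_add_left: "(c + d) *\<^sub>C x = c *\<^sub>C x + d *\<^sub>C x"
    and scaleC_scaleC: "c *\<^sub>C d *\<^sub>C x = (c * d) *\<^sub>C x"
    and scaleC_of_real: "complex_of_real r *\<^sub>C x = r *\<^sub>R x"
    and norm_scaleC: "norm (c *\<^sub>C x) = cmod c * norm x"

definition bounded_clinear :: "('a::complex_normed_vector \<Rightarrow> 'b::complex_normed_vector) \<Rightarrow> bool"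
  where "bounded_clinear f \<longleftrightarrow> bounded_linear f \<and> (\<forall>c x. f (c *\<^sub>C x) = c *\<^sub>C f x)"

text \<open>No unit is required, and the zero algebra is included.\<close>

class cstar_algebra = complex_normed_vector + real_normed_algebra + banach +
  fixes star :: "'a \<Rightarrow> 'a"
  assumes mult_scaleC_left: "(c *\<^sub>C x) * y = c *\<^sub>C (x * y)"
    and mult_scaleC_right: "x * (c *\<^sub>C y) = c *\<^sub>C (x * y)"
    and star_star: "star (star x) = x"
    and star_add: "star (x + y) = star x + star y"
    and star_scaleC: "star (c *\<^sub>C x) = cnj c *\<^sub>C star x"
    and star_mult: "star (x * y) = star y * star x"
    and norm_star_mult_self: "norm (star x * x) = (norm x)\<^sup>2"


section \<open>Hilbert spaces\<close>

text \<open>The inner product is antilinear in its first argument.\<close>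

class chilbert_space = complex_normed_vector + banach +
  fixes cinner :: "'a \<Rightarrow> 'a \<Rightarrow> complex"
  assumes cinner_commute: "cinner x y = cnj (cinner y x)"
    and cinner_add_right: "cinner x (y + z) = cinner x y + cinner x z"
    and cinner_scaleC_right: "cinner x (c *\<^sub>C y) = c * cinner x y"
    and cinner_self: "cinner x x = complex_of_real ((norm x)\<^sup>2)"

definition is_onb :: "'h::chilbert_space set \<Rightarrow> bool"
  where "is_onb E \<longleftrightarrow>
    (\<forall>e\<in>E. norm e = 1) \<and>
    (\<forall>e\<in>E. \<forall>f\<in>E. e \<noteq> f \<longrightarrow> cinner e f = 0) \<and>
    (\<forall>x. (\<forall>e\<in>E. cinner e x = 0) \<longrightarrow> x = 0)"

lemma scaleC_one [simp]: "1 *\<^sub>C x = (x :: 'a::complex_normed_vector)"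
  using scaleC_of_real[of 1 x] by simp

lemma scaleC_minus_right: "c *\<^sub>C (- x) = - (c *\<^sub>C (x :: 'a::complex_normed_vector))"
proof -
  have "- x = complex_of_real (-1) *\<^sub>C x" and "- (c *\<^sub>C x) = complex_of_real (-1) *\<^sub>C c *\<^sub>C x"
    unfolding scaleC_of_real by simp_all
  then show ?thesis by (metis mult.commute scaleC_scaleC)
qed

lemma scaleC_diff_right: "c *\<^sub>C (x - y) = c *\<^sub>C x - c *\<^sub>C (y :: 'a::complex_normed_vector)"
  using scaleC_add_right[of c x "- y"] by (simp add: scaleC_minus_right)

lemma scaleC_zero_right [simp]: "c *\<^sub>C 0 = (0 :: 'a::complex_normed_vector)"
  using scaleC_diff_right[of c 0 0] by simp

lemma scaleC_scaleR_commute: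
  "c *\<^sub>C r *\<^sub>R x = r *\<^sub>R c *\<^sub>C (x :: 'a::complex_normed_vector)"
  by (simp add: scaleC_of_real[symmetric] scaleC_scaleC mult.commute)

lemma bounded_linear_scaleC: "bounded_linear (\<lambda>x. c *\<^sub>C (x :: 'a::complex_normed_vector))"
  by (rule bounded_linear_intro[where K="cmod c"])
    (simp_all add: scaleC_add_right scaleC_scaleR_commute norm_scaleC mult.commute)

context
  fixes x y z :: "'h::chilbert_space"
begin

lemma cinner_scaleR_right: "cinner x (r *\<^sub>R y) = of_real r * cinner x y"
  by (metis cinner_scaleC_right scaleC_of_real)

lemma cinner_add_left: "cinner (x + y) z = cinner x z + cinner y z"
  by (metis cinner_add_right cinner_commute complex_cnj_add)

lemma cinner_scaleC_left: "cinner (c *\<^sub>C x) y = cnj c * cinner x y"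
  by (metis cinner_commute cinner_scaleC_right complex_cnj_mult)

lemma cinner_scaleR_left: "cinner (r *\<^sub>R x) y = of_real r * cinner x y"
  by (metis cinner_scaleC_left scaleC_of_real complex_cnj_complex_of_real)

lemma cinner_minus_right: "cinner x (- y) = - cinner x y"
  using cinner_scaleR_right[of "-1"] by simp

lemma cinner_minus_left: "cinner (- x) y = - cinner x y"
  using cinner_scaleR_left[of "-1"] by simp

end

lemma cinner_diff_right:
  "cinner x (y - z) = cinner x y - cinner x (z :: 'h::chilbert_space)"
  using cinner_add_right[of x y "- z"] by (simp add: cinner_minus_right)

lemma cinner_diff_left:
  "cinner (x - y) z = cinner x z - cinner y (z :: 'h::chilbert_space)"
  using cinner_add_left[of x "- y" z] by (simp add: cinner_minus_left)

lemmas cinner_simps = cinner_add_left cinner_add_right cinner_diff_left cinner_diff_right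
  cinner_minus_left cinner_minus_right cinner_scaleC_left cinner_scaleC_right
  cinner_scaleR_left cinner_scaleR_right

lemma Re_cinner_commute: "Re (cinner x y) = Re (cinner y (x :: 'h::chilbert_space))"
  by (subst cinner_commute) simp

lemma norm_sq_cinner: "(norm (x :: 'h::chilbert_space))\<^sup>2 = Re (cinner x x)"
  by (simp add: cinner_self)

lemma norm_add_sq:
  "(norm (x + y :: 'h::chilbert_space))\<^sup>2 = (norm x)\<^sup>2 + 2 * Re (cinner x y) + (norm y)\<^sup>2"
  by (simp add: norm_sq_cinner cinner_simps Re_cinner_commute[of y x])

lemma norm_diff_sq:
  "(norm (x - y :: 'h::chilbert_space))\<^sup>2 = (norm x)\<^sup>2 - 2 * Re (cinner x y) + (norm y)\<^sup>2"
  by (simp add: norm_sq_cinner cinner_simps Re_cinner_commute[of y x])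

lemma parallelogram:
  "(norm (x + y :: 'h::chilbert_space))\<^sup>2 + (norm (x - y))\<^sup>2 = 2 * (norm x)\<^sup>2 + 2 * (norm y)\<^sup>2"
  by (simp add: norm_add_sq norm_diff_sq)

lemma linear_coeff_zero:
  fixes b c :: real
  assumes "\<And>t. 0 \<le> t * b + t\<^sup>2 * c"
  shows "b = 0"
proof (rule ccontr)
  assume b: "b \<noteq> 0"
  define d where "d = \<bar>c\<bar> + 1"
  have d: "d > 0" "c < d" by (auto simp: d_def)
  have "0 \<le> (- b / d) * b + (- b / d)\<^sup>2 * c" by (rule assms)
  also have "(- b / d) * b + (- b / d)\<^sup>2 * c = b\<^sup>2 / d\<^sup>2 * (c - d)"
    using d by (simp add: field_simps power2_eq_square)
  also have "\<dots> < 0" using b d by (intro mult_pos_neg) auto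
  finally show False by simp
qed

lemma cinner_cauchy_schwarz: "cmod (cinner x y) \<le> norm x * norm (y :: 'h::chilbert_space)"
proof -
  have le: "Re (cinner u v) \<le> norm u * norm v" for u v :: 'h
  proof (cases "u = 0 \<or> v = 0")
    case True
    then show ?thesis
      using cinner_scaleR_left[of 0 u v] cinner_scaleR_right[of u 0 v] by auto
  next
    case False
    have "0 \<le> (norm (norm v *\<^sub>R u - norm u *\<^sub>R v))\<^sup>2" by simp
    also have "\<dots> = 2 * (norm u * norm v) * (norm u * norm v - Re (cinner u v))"
      unfolding norm_diff_sq by (simp add: cinner_simps power2_eq_square algebra_simps)
    finally show ?thesis
      using False by (auto simp: zero_le_mult_iff mult_le_0_iff)
  qed
  define w where "w = cnj (sgn (cinner x y))"
  have w: "w * cinner x y = cmod (cinner x y)"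
    unfolding w_def by (cases "cinner x y = 0")
      (auto simp: sgn_eq complex_norm_square[symmetric] power2_eq_square mult.commute)
  have "cmod (cinner x y) = Re (cinner x (w *\<^sub>C y))"
    by (simp add: cinner_simps w)
  also have "\<dots> \<le> norm x * norm (w *\<^sub>C y)" by (rule le)
  also have "\<dots> \<le> norm x * norm y"
    by (intro mult_left_mono) (auto simp: norm_scaleC w_def norm_sgn)
  finally show ?thesis .
qed

lemma cinner_ext: "(\<And>z. cinner z x = cinner z y) \<Longrightarrow> x = (y :: 'h::chilbert_space)"
  using norm_sq_cinner[of "x - y"] by (simp add: cinner_diff_right)

lemma riesz_representation:
  fixes f :: "'h::chilbert_space \<Rightarrow> complex"
  assumes bl: "bounded_linear f" and cl: "\<And>c x. f (c *\<^sub>C x) = c * f x"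
  shows "\<exists>z. \<forall>x. f x = cinner z x"
proof -
  interpret f: bounded_linear f by (rule bl)
  define \<phi> where "\<phi> x = (norm x)\<^sup>2 / 2 - Re (f x)" for x
  define m where "m = Inf (range \<phi>)"
  obtain K where K: "\<And>x. norm (f x) \<le> norm x * K" using f.bounded by blast
  have lower: "- K\<^sup>2 / 2 \<le> \<phi> x" for x
  proof -
    have "Re (f x) \<le> norm x * K" using K[of x] complex_Re_le_cmod[of "f x"] by linarith
    moreover have "0 \<le> (norm x - K)\<^sup>2" by simp
    ultimately show ?thesis unfolding \<phi>_def by (simp add: power2_eq_square algebra_simps)
  qed
  have bdd: "bdd_below (range \<phi>)" using lower by (auto intro!: bdd_belowI)
  have m_le: "m \<le> \<phi> x" for x unfolding m_def by (rule cInf_lower[OF _ bdd]) auto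
  have "\<exists>x. \<phi> x < m + 1 / Suc n" for n
    using cInf_lessD[of "range \<phi>" "m + 1 / Suc n"] by (auto simp: m_def)
  then obtain X where X: "\<And>n. \<phi> (X n) < m + 1 / Suc n" by metis
  have mid: "(norm (x - y))\<^sup>2 \<le> 4 * (\<phi> x + \<phi> y - 2 * m)" for x y
  proof -
    have "\<phi> ((1/2) *\<^sub>R (x + y)) = (norm (x + y))\<^sup>2 / 8 - Re (f x) / 2 - Re (f y) / 2"
      by (simp only: \<phi>_def f.scaleR f.add norm_scaleR)
        (simp add: power2_eq_square algebra_simps)
    then show ?thesis
      using m_le[of "(1/2) *\<^sub>R (x + y)"] parallelogram[of x y] by (simp add: \<phi>_def)
  qed
  have "Cauchy X"
  proof (rule CauchyI)
    fix e :: real assume e: "0 < e"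
    then obtain N where N: "8 / e\<^sup>2 < real N" using reals_Archimedean2 by blast
    have N0: "0 < real N" by (rule less_trans[OF _ N]) (use e in simp)
    show "\<exists>M. \<forall>i\<ge>M. \<forall>j\<ge>M. norm (X i - X j) < e"
    proof (intro exI[of _ N] allI impI)
      fix i j assume ij: "N \<le> i" "N \<le> j"
      have XN: "\<phi> (X n) < m + 1 / N" if "N \<le> n" for n
        using less_le_trans[OF X[of n], of "m + 1 / N"] that N0 by (simp add: frac_le)
      have "(norm (X i - X j))\<^sup>2 < 8 * (1 / N)"
        using mid[of "X i" "X j"] XN[OF ij(1)] XN[OF ij(2)] by (simp only: distrib_left right_diff_distrib)
      then have "(norm (X i - X j))\<^sup>2 < 8 / N" by simp
      also have "8 / N < e\<^sup>2" using N N0 e by (simp add: field_simps)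
      finally show "norm (X i - X j) < e" using e by (simp add: power2_less_imp_less)
    qed
  qed
  then obtain z where z: "X \<longlonglongrightarrow> z" using Cauchy_convergent convergent_def by blast
  have "(\<lambda>n. \<phi> (X n)) \<longlonglongrightarrow> \<phi> z"
    unfolding \<phi>_def by (intro tendsto_intros z f.tendsto) auto
  moreover have "(\<lambda>n. m + 1 / Suc n) \<longlonglongrightarrow> m + 0"
    by (intro tendsto_intros LIMSEQ_Suc lim_1_over_n)
  ultimately have zm: "\<phi> z \<le> m"
    using LIMSEQ_le[of "\<lambda>n. \<phi> (X n)" "\<phi> z" "\<lambda>n. m + 1 / Suc n" "m + 0"] X less_imp_le by auto
  have Re_eq: "Re (f h) = Re (cinner z h)" for h
  proof -
    have "0 \<le> t * (Re (cinner z h) - Re (f h)) + t\<^sup>2 * ((norm h)\<^sup>2 / 2)" for t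
    proof -
      have "\<phi> z \<le> \<phi> (z + t *\<^sub>R h)" using zm m_le order_trans by blast
      moreover have "\<phi> (z + t *\<^sub>R h) = \<phi> z + t * (Re (cinner z h) - Re (f h)) + t\<^sup>2 * ((norm h)\<^sup>2 / 2)"
        by (simp add: \<phi>_def norm_add_sq cinner_simps f.add f.scaleR power_mult_distrib algebra_simps)
      ultimately show ?thesis by linarith
    qed
    then show ?thesis using linear_coeff_zero by fastforce
  qed
  have "f h = cinner z h" for h
  proof (rule complex_eqI)
    show "Re (f h) = Re (cinner z h)" by (rule Re_eq)
    have "Re (- \<i> * f h) = Re (- \<i> * cinner z h)"
      using Re_eq[of "(- \<i>) *\<^sub>C h"] by (simp add: cl cinner_simps)
    then show "Im (f h) = Im (cinner z h)" by simp
  qed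
  then show ?thesis by blast
qed


section \<open>The \<open>C\<^sup>*\<close>-algebra of bounded operators\<close>

typedef (overloaded) 'h bop =
  "{A :: 'h::chilbert_space \<Rightarrow>\<^sub>L 'h. \<forall>c x. blinfun_apply A (c *\<^sub>C x) = c *\<^sub>C blinfun_apply A x}"
  morphisms blinfun_of_bop Abs_bop
  by (rule exI[of _ 0]) simp

setup_lifting type_definition_bop

definition bop_apply :: "'h::chilbert_space bop \<Rightarrow> 'h \<Rightarrow> 'h"
  where "bop_apply A x = blinfun_apply (blinfun_of_bop A) x"

text \<open>The vector space operations are pointwise, the product is composition, the norm is the
  operator norm.\<close>

instantiation bop :: (chilbert_space) real_normed_vector
begin

lift_definition zero_bop :: "'a bop" is 0 by simp
lift_definition plus_bop :: "'a bop \<Rightarrow> 'a bop \<Rightarrow> 'a bop" is "(+)"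
  by (simp add: plus_blinfun.rep_eq scaleC_add_right)
lift_definition minus_bop :: "'a bop \<Rightarrow> 'a bop \<Rightarrow> 'a bop" is "(-)"
  by (simp add: minus_blinfun.rep_eq scaleC_diff_right)
lift_definition uminus_bop :: "'a bop \<Rightarrow> 'a bop" is uminus
  by (simp add: uminus_blinfun.rep_eq scaleC_minus_right)
lift_definition scaleR_bop :: "real \<Rightarrow> 'a bop \<Rightarrow> 'a bop" is "(*\<^sub>R)"
  by (simp add: scaleR_blinfun.rep_eq scaleC_scaleR_commute)
lift_definition norm_bop :: "'a bop \<Rightarrow> real" is norm .
definition sgn_bop :: "'a bop \<Rightarrow> 'a bop" where "sgn_bop A = scaleR (inverse (norm A)) A"
definition dist_bop :: "'a bop \<Rightarrow> 'a bop \<Rightarrow> real" where "dist_bop A B = norm (A - B)"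
definition uniformity_bop :: "('a bop \<times> 'a bop) filter"
  where "uniformity_bop = (INF e\<in>{0<..}. principal {(A, B). dist A B < e})"
definition open_bop :: "'a bop set \<Rightarrow> bool"
  where "open_bop S = (\<forall>A\<in>S. \<forall>\<^sub>F (A', B) in uniformity. A' = A \<longrightarrow> B \<in> S)"

instance
proof
  fix A B C :: "'a bop" and r s :: real
  show "A + B + C = A + (B + C)" "A + B = B + A" "0 + A = A" "- A + A = 0" "A - B = A + - B"
    "r *\<^sub>R (A + B) = r *\<^sub>R A + r *\<^sub>R B" "(r + s) *\<^sub>R A = r *\<^sub>R A + s *\<^sub>R A"
    "r *\<^sub>R s *\<^sub>R A = (r * s) *\<^sub>R A" "1 *\<^sub>R A = A" "norm A = 0 \<longleftrightarrow> A = 0"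
    "norm (A + B) \<le> norm A + norm B" "norm (r *\<^sub>R A) = \<bar>r\<bar> * norm A"
    by (transfer, simp add: algebra_simps norm_triangle_ineq)+
  show "sgn A = inverse (norm A) *\<^sub>R A" "dist A B = norm (A - B)"
    "(uniformity :: ('a bop \<times> 'a bop) filter) = (INF e\<in>{0<..}. principal {(A, B). dist A B < e})"
    by (simp_all add: sgn_bop_def dist_bop_def uniformity_bop_def)
  show "open S = (\<forall>A\<in>S. \<forall>\<^sub>F (A', B) in uniformity. A' = A \<longrightarrow> B \<in> S)" for S :: "'a bop set"
    by (rule open_bop_def)
qed

end

lemma bop_eqI: "(\<And>x. bop_apply A x = bop_apply B x) \<Longrightarrow> A = B"
  unfolding bop_apply_def by (metis blinfun_eqI blinfun_of_bop_inject)

lemma bop_apply_zero_left [simp]: "bop_apply 0 x = 0"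
  by (simp add: bop_apply_def zero_bop.rep_eq)

lemma bop_apply_add_left: "bop_apply (A + B) x = bop_apply A x + bop_apply B x"
  by (simp add: bop_apply_def plus_bop.rep_eq blinfun.bilinear_simps)

lemma bop_apply_minus_left: "bop_apply (- A) x = - bop_apply A x"
  by (simp add: bop_apply_def uminus_bop.rep_eq blinfun.bilinear_simps)

lemma bop_apply_diff_left: "bop_apply (A - B) x = bop_apply A x - bop_apply B x"
  by (simp add: bop_apply_def minus_bop.rep_eq blinfun.bilinear_simps)

lemma bop_apply_scaleR_left: "bop_apply (r *\<^sub>R A) x = r *\<^sub>R bop_apply A x"
  by (simp add: bop_apply_def scaleR_bop.rep_eq blinfun.bilinear_simps)

instantiation bop :: (chilbert_space) complex_normed_vector
begin

lift_definition scaleC_bop :: "complex \<Rightarrow> 'a bop \<Rightarrow> 'a bop"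
  is "\<lambda>c A. Blinfun (\<lambda>x. c *\<^sub>C blinfun_apply A x)"
  by (subst (1 2) bounded_linear_Blinfun_apply)
    (auto intro: bounded_linear_compose[OF bounded_linear_scaleC blinfun.bounded_linear_right]
      simp: scaleC_scaleC mult.commute)

lemma Blinfun_scaleC_apply:
  "blinfun_apply (Blinfun (\<lambda>x. c *\<^sub>C blinfun_apply A x)) x = c *\<^sub>C blinfun_apply (A :: 'a \<Rightarrow>\<^sub>L 'a) x"
  by (subst bounded_linear_Blinfun_apply)
    (auto intro: bounded_linear_compose[OF bounded_linear_scaleC blinfun.bounded_linear_right])

lemma bop_apply_scaleC_left: "bop_apply (c *\<^sub>C A) x = c *\<^sub>C bop_apply (A :: 'a bop) x"
  by (simp add: bop_apply_def scaleC_bop.rep_eq Blinfun_scaleC_apply)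

lemma norm_Blinfun_scaleC:
  "norm (Blinfun (\<lambda>x. c *\<^sub>C blinfun_apply A x)) = cmod c * norm (A :: 'a \<Rightarrow>\<^sub>L 'a)"
proof -
  have "norm (Blinfun (\<lambda>x. c *\<^sub>C blinfun_apply A x)) = norm (cmod c *\<^sub>R A)"
    by (simp only: norm_blinfun.rep_eq onorm_def Blinfun_scaleC_apply scaleR_blinfun.rep_eq
        norm_scaleC norm_scaleR abs_norm_cancel)
  then show ?thesis by simp
qed

instance
proof
  fix A B :: "'a bop" and c d :: complex and r :: real
  show "c *\<^sub>C (A + B) = c *\<^sub>C A + c *\<^sub>C B" "(c + d) *\<^sub>C A = c *\<^sub>C A + d *\<^sub>C A"
    "c *\<^sub>C d *\<^sub>C A = (c * d) *\<^sub>C A" "complex_of_real r *\<^sub>C A = r *\<^sub>R A"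
    by (rule bop_eqI, simp only: bop_apply_scaleC_left bop_apply_add_left bop_apply_scaleR_left
        scaleC_add_right scaleC_add_left scaleC_scaleC scaleC_of_real)+
  show "norm (c *\<^sub>C A) = cmod c * norm A"
    by transfer (rule norm_Blinfun_scaleC)
qed

end

lemma bounded_linear_bop_apply: "bounded_linear (bop_apply A)"
  unfolding bop_apply_def by (rule blinfun.bounded_linear_right)

lemma bop_apply_scaleC: "bop_apply A (c *\<^sub>C x) = c *\<^sub>C bop_apply A x"
  unfolding bop_apply_def using blinfun_of_bop[of A] by simp

lemma norm_bop_apply: "norm (bop_apply A x) \<le> norm A * norm x"
  by (simp add: bop_apply_def norm_bop.rep_eq norm_blinfun)

lemma norm_bop_bound:
  "0 \<le> b \<Longrightarrow> (\<And>x. norm (bop_apply A x) \<le> b * norm x) \<Longrightarrow> norm A \<le> b"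
  by (simp add: bop_apply_def norm_bop.rep_eq norm_blinfun_bound)

lemma bop_exists:
  assumes "bounded_clinear f"
  shows "\<exists>A. bop_apply A = f"
proof -
  have "blinfun_of_bop (Abs_bop (Blinfun f)) = Blinfun f"
    using assms by (intro Abs_bop_inverse) (simp add: bounded_clinear_def bounded_linear_Blinfun_apply)
  then have "bop_apply (Abs_bop (Blinfun f)) = f"
    using assms by (auto simp: bop_apply_def bounded_clinear_def bounded_linear_Blinfun_apply)
  then show ?thesis by blast
qed

instance bop :: (chilbert_space) banach
proof
  fix X :: "nat \<Rightarrow> 'a bop" assume X: "Cauchy X"
  have "Cauchy (\<lambda>n. blinfun_of_bop (X n))"
    using X unfolding Cauchy_def dist_norm norm_bop.rep_eq minus_bop.rep_eq .
  then obtain L where L: "(\<lambda>n. blinfun_of_bop (X n)) \<longlonglongrightarrow> L"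
    by (auto dest!: Cauchy_convergent simp: convergent_def)
  have ptw: "(\<lambda>n. blinfun_apply (blinfun_of_bop (X n)) x) \<longlonglongrightarrow> blinfun_apply L x" for x
    by (intro blinfun.tendsto L tendsto_const)
  have "blinfun_apply L (c *\<^sub>C x) = c *\<^sub>C blinfun_apply L x" for c x
  proof (rule LIMSEQ_unique[OF ptw])
    have "blinfun_apply (blinfun_of_bop (X n)) (c *\<^sub>C x) = c *\<^sub>C blinfun_apply (blinfun_of_bop (X n)) x"
      for n using blinfun_of_bop[of "X n"] by simp
    then show "(\<lambda>n. blinfun_apply (blinfun_of_bop (X n)) (c *\<^sub>C x)) \<longlonglongrightarrow> c *\<^sub>C blinfun_apply L x"
      using bounded_linear.tendsto[OF bounded_linear_scaleC ptw] by simp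
  qed
  then have "blinfun_of_bop (Abs_bop L) = L" by (intro Abs_bop_inverse) simp
  then have "X \<longlonglongrightarrow> Abs_bop L"
    using L unfolding tendsto_iff dist_norm norm_bop.rep_eq minus_bop.rep_eq by simp
  then show "convergent X" by (auto simp: convergent_def)
qed

lemma adjoint_exists: "\<exists>B. \<forall>x y. cinner (bop_apply B x) y = cinner x (bop_apply A y)"
proof -
  interpret A: bounded_linear "bop_apply A" by (rule bounded_linear_bop_apply)
  have "\<exists>z. \<forall>y. cinner x (bop_apply A y) = cinner z y" for x
  proof (rule riesz_representation)
    show "bounded_linear (\<lambda>y. cinner x (bop_apply A y))"
    proof (rule bounded_linear_intro[where K="norm x * norm A"])
      show "norm (cinner x (bop_apply A y)) \<le> norm y * (norm x * norm A)" for y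
        using order_trans[OF cinner_cauchy_schwarz mult_left_mono[OF norm_bop_apply norm_ge_zero]]
        by (metis mult.assoc mult.commute)
    qed (simp_all add: A.add A.scaleR cinner_simps scaleR_conv_of_real)
  qed (simp add: bop_apply_scaleC cinner_simps)
  then obtain g where g: "\<And>x y. cinner (g x) y = cinner x (bop_apply A y)" by metis
  have eqI: "u = v" if "\<And>y. cinner u y = cinner v y" for u v :: 'a
    using that by (intro cinner_ext) (metis cinner_commute)
  have gb: "norm (g x) \<le> norm x * norm A" for x
  proof -
    have "(norm (g x))\<^sup>2 = cmod (cinner x (bop_apply A (g x)))"
      by (subst g[symmetric]) (simp add: cinner_self norm_power)
    also have "\<dots> \<le> norm x * (norm A * norm (g x))"
      by (rule order_trans[OF cinner_cauchy_schwarz mult_left_mono[OF norm_bop_apply norm_ge_zero]])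
    finally show ?thesis
      by (cases "g x = 0") (auto simp: power2_eq_square)
  qed
  have "bounded_clinear g"
    unfolding bounded_clinear_def
  proof (intro conjI allI)
    show "bounded_linear g"
      by (rule bounded_linear_intro[OF _ _ gb]) (rule eqI, simp add: g cinner_simps)+
    show "g (c *\<^sub>C x) = c *\<^sub>C g x" for c x
      by (rule eqI) (simp add: g cinner_simps)
  qed
  then obtain B where "bop_apply B = g" using bop_exists by blast
  then show ?thesis using g by metis
qed

instantiation bop :: (chilbert_space) cstar_algebra
begin

lift_definition times_bop :: "'a bop \<Rightarrow> 'a bop \<Rightarrow> 'a bop" is blinfun_compose
  by simp

definition star_bop :: "'a bop \<Rightarrow> 'a bop"
  where "star_bop A = (THE B. \<forall>x y. cinner (bop_apply B x) y = cinner x (bop_apply A y))"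

lemma bop_apply_times: "bop_apply (A * B) x = bop_apply A (bop_apply B x)" for A B :: "'a bop"
  by (simp add: bop_apply_def times_bop.rep_eq)

lemma bop_eqI_cinner:
  assumes "\<And>x y. cinner (bop_apply A x) y = cinner (bop_apply B x) y"
  shows "A = (B :: 'a bop)"
  by (rule bop_eqI, rule cinner_ext) (metis assms cinner_commute)

lemma cinner_star_left:
  "cinner (bop_apply (star A) x) y = cinner x (bop_apply (A :: 'a bop) y)"
proof -
  have "\<exists>!B. \<forall>x y. cinner (bop_apply B x) y = cinner x (bop_apply A y)"
    using adjoint_exists[of A] by (metis bop_eqI_cinner)
  from theI'[OF this] show ?thesis unfolding star_bop_def by blast
qed

lemma cinner_star_right:
  "cinner x (bop_apply (star A) y) = cinner (bop_apply (A :: 'a bop) x) y"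
  by (metis cinner_commute cinner_star_left)

instance
proof
  fix A B C :: "'a bop" and c :: complex and r :: real
  note ap = bop_apply_times bop_apply_add_left bop_apply_scaleR_left bop_apply_scaleC_left
    bop_apply_scaleC linear_add[OF bounded_linear.linear[OF bounded_linear_bop_apply]]
    linear_scale[OF bounded_linear.linear[OF bounded_linear_bop_apply]]
  show "A * B * C = A * (B * C)" "(A + B) * C = A * C + B * C" "A * (B + C) = A * B + A * C"
    "r *\<^sub>R A * B = r *\<^sub>R (A * B)" "A * r *\<^sub>R B = r *\<^sub>R (A * B)"
    "c *\<^sub>C A * B = c *\<^sub>C (A * B)" "A * c *\<^sub>C B = c *\<^sub>C (A * B)"
    by (rule bop_eqI, simp add: ap)+
  show mult: "norm (A * B) \<le> norm A * norm B" for A B :: "'a bop"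
    by transfer (rule norm_blinfun_compose)
  show ss: "star (star A) = A" for A :: "'a bop"
    by (rule bop_eqI_cinner) (simp add: cinner_star_left cinner_star_right)
  show "star (A + B) = star A + star B" "star (c *\<^sub>C A) = cnj c *\<^sub>C star A"
    "star (A * B) = star B * star A"
    by (rule bop_eqI_cinner, simp add: cinner_star_left ap cinner_simps)+
  have sq: "(norm A)\<^sup>2 \<le> norm (star A * A)" for A :: "'a bop"
  proof -
    have "norm A \<le> sqrt (norm (star A * A))"
    proof (rule norm_bop_bound)
      fix x
      have "(norm (bop_apply A x))\<^sup>2 = cmod (cinner (bop_apply (star A * A) x) x)"
        by (simp add: bop_apply_times cinner_star_left cinner_self norm_power)
      also have "\<dots> \<le> norm (star A * A) * norm x * norm x"
        by (rule order_trans[OF cinner_cauchy_schwarz mult_right_mono[OF norm_bop_apply norm_ge_zero]])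
      also have "\<dots> = (sqrt (norm (star A * A)) * norm x)\<^sup>2"
        by (simp add: power_mult_distrib power2_eq_square)
      finally show "norm (bop_apply A x) \<le> sqrt (norm (star A * A)) * norm x"
        by (rule power2_le_imp_le) simp
    qed simp
    then show ?thesis by (metis norm_ge_zero power_mono real_sqrt_pow2)
  qed
  have le: "norm A \<le> norm (star A)" for A :: "'a bop"
  proof (cases "norm A = 0")
    case False
    have "norm A * norm A \<le> norm (star A) * norm A"
      using order_trans[OF sq mult, of A] by (simp add: power2_eq_square)
    then show ?thesis using False by simp
  qed simp
  have "norm (star A) = norm A" using le[of A] le[of "star A"] ss[of A] by simp
  then have "norm (star A * A) \<le> (norm A)\<^sup>2"
    using mult[of "star A" A] by (simp add: power2_eq_square)
  with sq[of A] show "norm (star A * A) = (norm A)\<^sup>2" by simp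
qed

end


section \<open>Trace class operators, trace and transpose\<close>

definition positive_op :: "'h::chilbert_space bop \<Rightarrow> bool"
  where "positive_op A \<longleftrightarrow> (\<forall>x. 0 \<le> cinner x (bop_apply A x))"

text \<open>The operator \<open>P\<close> below is \<open>\<bar>A\<bar> = (A\<^sup>* A)\<^bsup>1/2\<^esup>\<close>.\<close>

definition trace_class :: "'h::chilbert_space bop \<Rightarrow> bool"
  where "trace_class A \<longleftrightarrow>
    (\<exists>P E. positive_op P \<and> P * P = star A * A \<and> is_onb E \<and>
      (\<lambda>e. cinner e (bop_apply P e)) summable_on E)"

text \<open>On trace class operators the value does not depend on the chosen basis.\<close>

definition op_trace :: "'h::chilbert_space bop \<Rightarrow> complex"
  where "op_trace A = (\<Sum>\<^sub>\<infinity>e\<in>(SOME E. is_onb E). cinner e (bop_apply A e))"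

definition op_transpose :: "'h::chilbert_space set \<Rightarrow> 'h bop \<Rightarrow> 'h bop"
  where "op_transpose E A =
    (THE B. \<forall>e\<in>E. \<forall>f\<in>E. cinner e (bop_apply B f) = cinner f (bop_apply A e))"


section \<open>Positive matrices and \<open>k\<close>-positive maps\<close>

text \<open>Square matrices over \<open>'a\<close> of size \<open>k = CARD('k)\<close> are elements of \<open>'a^'k^'k\<close>. The library product
  of matrices needs entries from a ring with unit.\<close>

definition mat_mult :: "'a::cstar_algebra^'k^'k \<Rightarrow> 'a^'k^'k \<Rightarrow> 'a^'k^'k"
  where "mat_mult A B = (\<chi> i j. \<Sum>l\<in>UNIV. A $ i $ l * B $ l $ j)"

definition mat_star :: "'a::cstar_algebra^'k^'k \<Rightarrow> 'a^'k^'k"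
  where "mat_star A = (\<chi> i j. star (A $ j $ i))"

text \<open>Positive elements of the \<open>C\<^sup>*\<close>-algebra \<open>M\<^sub>k(\<AA>)\<close>, i.e. those of the form \<open>B\<^sup>* B\<close>.\<close>

definition mat_positive :: "'a::cstar_algebra^'k^'k \<Rightarrow> bool"
  where "mat_positive A \<longleftrightarrow> (\<exists>B. A = mat_mult (mat_star B) B)"

definition k_positive :: "'k::finite itself \<Rightarrow> ('a::cstar_algebra \<Rightarrow> 'b::cstar_algebra) \<Rightarrow> bool"
  where "k_positive _ T \<longleftrightarrow> (\<forall>A :: 'a^'k^'k. mat_positive A \<longrightarrow> mat_positive (map_matrix T A))"

text \<open>The cone \<open>M\<^sub>k(\<B>(\<H>)\<^sub>*)\<^sup>+\<close>: a matrix of operators acts on \<open>\<complex>\<^sup>k \<otimes> \<H> = \<H>\<^sup>k\<close>.\<close>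

definition predual_mat_positive :: "'h::chilbert_space bop^'k^'k \<Rightarrow> bool"
  where "predual_mat_positive R \<longleftrightarrow>
    (\<forall>i j. trace_class (R $ i $ j)) \<and>
    (\<forall>\<xi> :: 'h^'k. 0 \<le> (\<Sum>i\<in>UNIV. \<Sum>j\<in>UNIV. cinner (\<xi> $ i) (bop_apply (R $ i $ j) (\<xi> $ j))))"

end

theory Submission
  imports Defs
begin

text \<open>
  An operator matrix in \<open>M\<^sub>k(\<B>(\<H>))\<close> has the form \<open>B\<^sup>* B\<close> if and only if its quadratic form on \<open>\<H>\<^sup>k\<close>
  is nonnegative (\<open>mat_positive_iff\<close>). This rests on the existence of square roots of positive
  operators on the Hilbert space \<open>\<H>\<^sup>k\<close> (\<open>positive_sqrt_exists\<close>).

  For the condition on traces to imply \<open>k\<close>-positivity, a single rank one matrix suffices. Let \<open>J\<close>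
  be the conjugation of \<open>\<H>\<close> that fixes the basis \<open>E\<close>; then \<open>A\<^sup>t = J A\<^sup>* J\<close>
  (\<open>cinner_op_transpose\<close>). For \<open>\<xi> \<in> \<H>\<^sup>k\<close>, the entries \<open>\<rho>\<^sub>i\<^sub>j = |J \<xi>\<^sub>i\<rangle>\<langle>J \<xi>\<^sub>j|\<close> form a
  positive matrix with \<open>\<rho>\<^sub>i\<^sub>j\<^sup>t = |\<xi>\<^sub>j\<rangle>\<langle>\<xi>\<^sub>i|\<close>, so that the sum of the traces is the quadratic form
  \<open>\<Sum> \<langle>\<xi>\<^sub>i, T(a\<^sub>i\<^sub>j) \<xi>\<^sub>j\<rangle>\<close>.

  Conversely, let \<open>T\<close> be \<open>k\<close>-positive. Each \<open>p\<close> contributes \<open>Tr (M N)\<close>, the trace on \<open>\<H>\<^sup>k\<close>, for the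
  matrices \<open>M = [T(a\<^sub>i\<^sub>j)]\<close> and \<open>N = [\<rho>\<^sub>j\<^sub>i\<^sup>t]\<close>. The matrix \<open>M = B\<^sup>* B\<close> is positive by hypothesis, and
  \<open>N = W\<^sup>* W\<close> is positive because transposing the entries and the positions at once is \<open>R \<mapsto> J R\<^sup>* J\<close>
  on \<open>\<H>\<^sup>k\<close>. Hence \<open>Tr (M N) = Tr ((B W\<^sup>* )(B W\<^sup>* )\<^sup>* ) \<ge> 0\<close>. To justify the cyclic
  permutation, \<open>W\<close> has to be Hilbert-Schmidt (\<open>transposed_predual_matrix\<close>). Its entries are,
  because \<open>\<Sum>\<^sub>m \<parallel>W\<^sub>m\<^sub>i e\<parallel>\<^sup>2 = \<langle>e, \<rho>\<^sub>i\<^sub>i e\<rangle>\<close> for \<open>e \<in> E\<close>, and the sum over \<open>e\<close> is finite for a trace class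
  operator \<open>\<rho>\<^sub>i\<^sub>i\<close>. As the definition of trace class only provides some \<open>P \<ge> 0\<close> with
  \<open>P\<^sup>2 = \<rho>\<^sub>i\<^sub>i\<^sup>* \<rho>\<^sub>i\<^sub>i\<close> and some basis in which \<open>P\<close> is summable, this uses the uniqueness of the positive square
  root (\<open>positive_sqrt_unique\<close>) and the independence of Hilbert-Schmidt sums from the basis
  (\<open>hilbert_schmidt_has_sum\<close>). The trace itself is then treated as an inner product of
  Hilbert-Schmidt operators, \<open>Tr (X\<^sup>* Y) = Tr (Y X\<^sup>* )\<close> (\<open>hilbert_schmidt_inner\<close>).
\<close>

section \<open>Orthonormal bases\<close>

lemma cinner_zero_right [simp]: "cinner x 0 = (0::complex)"
  using cinner_diff_right[of x 0 0] by simp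

lemma cinner_zero_left [simp]: "cinner 0 x = (0::complex)"
  using cinner_diff_left[of 0 0 x] by simp

lemma cinner_sum_right: "cinner x (sum f G) = (\<Sum>g\<in>G. cinner x (f g))"
  by (induction G rule: infinite_finite_induct) (simp_all add: cinner_add_right)

lemma cinner_sum_left: "cinner (sum f G) x = (\<Sum>g\<in>G. cinner (f g) x)"
  by (induction G rule: infinite_finite_induct) (simp_all add: cinner_add_left)

lemma cinner_mult_commute: "cinner x y * cinner y x = of_real ((cmod (cinner x y))\<^sup>2)"
  by (subst (2) cinner_commute) (simp only: complex_norm_square)

lemma cmod_cinner_commute: "cmod (cinner x y) = cmod (cinner y x)"
  by (subst cinner_commute) simp

lemma cinner_self_ge_0: "0 \<le> cinner x x"
  by (simp add: cinner_self less_eq_complex_def)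

lemma onb_cinner:
  assumes "is_onb F" "e \<in> F" "f \<in> F"
  shows "cinner e f = (if e = f then 1 else 0)"
  using assms by (auto simp: is_onb_def cinner_self)

lemma onb_eqI:
  assumes "is_onb F" "\<And>e. e \<in> F \<Longrightarrow> cinner e x = cinner e y"
  shows "x = y"
proof -
  have "x - y = 0"
    using assms unfolding is_onb_def by (metis cinner_diff_right eq_iff_diff_eq_0)
  then show ?thesis by simp
qed

lemma onb_cinner_sum:
  assumes "is_onb F" "finite G" "G \<subseteq> F" "e \<in> G"
  shows "cinner e (\<Sum>g\<in>G. c g *\<^sub>C g) = c e"
proof -
  have "cinner e (\<Sum>g\<in>G. c g *\<^sub>C g) = (\<Sum>g\<in>G. if g = e then c g else 0)"
    unfolding cinner_sum_right
    using assms by (intro sum.cong refl) (auto simp: cinner_scaleC_right onb_cinner[OF assms(1)] subset_iff)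
  then show ?thesis using assms by simp
qed

lemma onb_norm_sum:
  assumes "is_onb F" "finite G" "G \<subseteq> F"
  shows "(norm (\<Sum>g\<in>G. c g *\<^sub>C g))\<^sup>2 = (\<Sum>g\<in>G. (cmod (c g))\<^sup>2)"
proof -
  have "complex_of_real ((norm (\<Sum>g\<in>G. c g *\<^sub>C g))\<^sup>2) = (\<Sum>g\<in>G. cnj (c g) * c g)"
    unfolding cinner_self[symmetric]
    by (subst cinner_sum_left) (simp add: cinner_scaleC_left onb_cinner_sum[OF assms])
  also have "\<dots> = of_real (\<Sum>g\<in>G. (cmod (c g))\<^sup>2)"
    unfolding of_real_sum by (intro sum.cong refl) (simp only: complex_norm_square mult.commute)
  finally show ?thesis using of_real_eq_iff by blast
qed

lemma bessel:
  assumes "is_onb F" "finite G" "G \<subseteq> F"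
  shows "(\<Sum>g\<in>G. (cmod (cinner g x))\<^sup>2) \<le> (norm x)\<^sup>2"
proof -
  define v where "v = (\<Sum>g\<in>G. cinner g x *\<^sub>C g)"
  have "cinner x v = of_real (\<Sum>g\<in>G. (cmod (cinner g x))\<^sup>2)"
    unfolding v_def cinner_sum_right of_real_sum
    by (intro sum.cong refl) (simp only: cinner_scaleC_right cinner_mult_commute)
  moreover have "(norm v)\<^sup>2 = (\<Sum>g\<in>G. (cmod (cinner g x))\<^sup>2)"
    unfolding v_def by (rule onb_norm_sum[OF assms])
  moreover have "0 \<le> (norm (x - v))\<^sup>2" by simp
  ultimately show ?thesis unfolding norm_diff_sq by simp
qed

text \<open>The coefficients of a convergent expansion define a bounded functional, so the vector is
  supplied by the Riesz representation theorem and no convergence in \<open>\<H>\<close> has to be discussed.\<close>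

lemma riesz_fischer:
  assumes F: "is_onb F"
    and bound: "\<And>G. finite G \<Longrightarrow> G \<subseteq> F \<Longrightarrow> (\<Sum>g\<in>G. (cmod (c g))\<^sup>2) \<le> C"
  obtains z where "\<And>e. e \<in> F \<Longrightarrow> cinner e z = c e"
    and "\<And>x. ((\<lambda>e. cnj (c e) * cinner e x) has_sum cinner z x) F"
proof -
  define \<phi> where "\<phi> x = (\<Sum>\<^sub>\<infinity>e\<in>F. cnj (c e) * cinner e x)" for x
  have fin: "cmod (\<Sum>e\<in>G. cnj (c e) * cinner e x) \<le> sqrt C * norm x"
    if G: "finite G" "G \<subseteq> F" for G x
  proof -
    have "(\<Sum>e\<in>G. cnj (c e) * cinner e x) = cinner (\<Sum>g\<in>G. c g *\<^sub>C g) x"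
      by (simp add: cinner_sum_left cinner_scaleC_left)
    also have "cmod \<dots> \<le> norm (\<Sum>g\<in>G. c g *\<^sub>C g) * norm x" by (rule cinner_cauchy_schwarz)
    also have "norm (\<Sum>g\<in>G. c g *\<^sub>C g) \<le> sqrt C"
      using bound[OF G] onb_norm_sum[OF F G, of c] by (intro real_le_rsqrt) simp
    finally show ?thesis by (simp add: mult_right_mono)
  qed
  have summ: "(\<lambda>e. cnj (c e) * cinner e x) summable_on F" for x
  proof -
    have "Infinite_Sum.abs_summable_on (\<lambda>e. cnj (c e) * cinner e x) F"
      unfolding abs_summable_iff_bdd_above
    proof (rule bdd_aboveI2)
      fix G assume "G \<in> {G. G \<subseteq> F \<and> finite G}"
      then have G: "finite G" "G \<subseteq> F" by auto
      have "(\<Sum>e\<in>G. cmod (cnj (c e) * cinner e x))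
          \<le> (\<Sum>e\<in>G. ((cmod (c e))\<^sup>2 + (cmod (cinner e x))\<^sup>2) / 2)"
      proof (rule sum_mono)
        fix e
        have "0 \<le> (cmod (c e) - cmod (cinner e x))\<^sup>2" by simp
        then show "cmod (cnj (c e) * cinner e x) \<le> ((cmod (c e))\<^sup>2 + (cmod (cinner e x))\<^sup>2) / 2"
          by (simp add: norm_mult power2_diff)
      qed
      also have "\<dots> = ((\<Sum>e\<in>G. (cmod (c e))\<^sup>2) + (\<Sum>e\<in>G. (cmod (cinner e x))\<^sup>2)) / 2"
        by (simp add: sum_divide_distrib[symmetric] sum.distrib)
      also have "\<dots> \<le> (C + (norm x)\<^sup>2) / 2"
        using bound[OF G] bessel[OF F G, of x] by simp
      finally show "(\<Sum>e\<in>G. cmod (cnj (c e) * cinner e x)) \<le> (C + (norm x)\<^sup>2) / 2" .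
    qed
    then show ?thesis by (rule abs_summable_summable)
  qed
  have hs: "((\<lambda>e. cnj (c e) * cinner e x) has_sum \<phi> x) F" for x
    unfolding \<phi>_def by (rule has_sum_infsum[OF summ])
  have "\<exists>z. \<forall>x. \<phi> x = cinner z x"
  proof (rule riesz_representation)
    show scale: "\<phi> (a *\<^sub>C x) = a * \<phi> x" for a x
      using has_sum_cmult_right[OF hs[of x], of a]
      by (intro has_sum_unique[OF hs]) (simp add: cinner_scaleC_right algebra_simps)
    show "bounded_linear \<phi>"
    proof (rule bounded_linear_intro[where K="sqrt C"])
      show "\<phi> (x + y) = \<phi> x + \<phi> y" for x y
        using has_sum_add[OF hs[of x] hs[of y]]
        by (intro has_sum_unique[OF hs]) (simp add: cinner_add_right algebra_simps)
      show "\<phi> (r *\<^sub>R x) = r *\<^sub>R \<phi> x" for r x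
        using scale[of "of_real r" x] by (simp add: scaleC_of_real scaleR_conv_of_real)
      show "norm (\<phi> x) \<le> norm x * sqrt C" for x
      proof (rule tendsto_upperbound)
        show "((\<lambda>G. cmod (\<Sum>e\<in>G. cnj (c e) * cinner e x)) \<longlongrightarrow> norm (\<phi> x))
            (finite_subsets_at_top F)"
          using hs[of x] unfolding has_sum_def by (rule tendsto_norm)
        show "\<forall>\<^sub>F G in finite_subsets_at_top F.
            cmod (\<Sum>e\<in>G. cnj (c e) * cinner e x) \<le> norm x * sqrt C"
          using fin by (intro eventually_finite_subsets_at_top_weakI) (simp add: mult.commute)
      qed simp
    qed
  qed
  then obtain z where z: "\<And>x. \<phi> x = cinner z x" by blast
  have "cinner e z = c e" if e: "e \<in> F" for e
  proof -
    have "((\<lambda>f. cnj (c f) * cinner f e) has_sum cnj (c e)) F"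
      by (rule has_sum_finite_neutralI[of "{e}"])
        (use e in \<open>auto simp: onb_cinner[OF F e] onb_cinner[OF F _ e]\<close>)
    then have "cinner z e = cnj (c e)"
      using has_sum_unique hs z by metis
    then show ?thesis by (metis cinner_commute complex_cnj_cnj)
  qed
  then show ?thesis using that hs z by metis
qed

lemma parseval:
  assumes F: "is_onb F"
  shows "((\<lambda>e. cinner y e * cinner e x) has_sum cinner y x) F"
proof -
  obtain z where z: "\<And>e. e \<in> F \<Longrightarrow> cinner e z = cinner e y"
    and s: "\<And>x. ((\<lambda>e. cnj (cinner e y) * cinner e x) has_sum cinner z x) F"
    using riesz_fischer[OF F bessel[OF F]] by metis
  have "z = y" by (rule onb_eqI[OF F z])
  then show ?thesis using s[of x] by (metis (no_types, lifting) cinner_commute has_sum_cong)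
qed

lemma parseval_norm:
  assumes F: "is_onb F"
  shows "((\<lambda>e. (cmod (cinner e x))\<^sup>2) has_sum (norm x)\<^sup>2) F"
proof -
  have "((\<lambda>e. complex_of_real ((cmod (cinner e x))\<^sup>2)) has_sum of_real ((norm x)\<^sup>2)) F"
    using parseval[OF F, of x x] 
    by (simp only: cinner_mult_commute cinner_self cmod_cinner_commute[of x])
  then show ?thesis unfolding has_sum_of_real_iff .
qed

section \<open>Positive operators and their square roots\<close>

lemmas bop_apply_linear = bounded_linear.linear[OF bounded_linear_bop_apply]

lemmas bop_apply_simps = bop_apply_times bop_apply_add_left bop_apply_diff_left
  bop_apply_minus_left bop_apply_scaleR_left bop_apply_scaleC_left bop_apply_scaleC
  linear_add[OF bop_apply_linear] linear_diff[OF bop_apply_linear] linear_neg[OF bop_apply_linear]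
  linear_scale[OF bop_apply_linear] linear_0[OF bop_apply_linear] linear_sum[OF bop_apply_linear]

lemma bop_apply_sum_left: "bop_apply (sum f G) x = (\<Sum>g\<in>G. bop_apply (f g) x)"
  by (induction G rule: infinite_finite_induct) (simp_all add: bop_apply_add_left)

lemma bop_eqI_cinner_right:
  assumes "\<And>x y. cinner x (bop_apply A y) = cinner x (bop_apply B y)"
  shows "A = B"
  by (rule bop_eqI, rule cinner_ext) (rule assms)

definition bop_of :: "('h::chilbert_space \<Rightarrow> 'h) \<Rightarrow> 'h bop"
  where "bop_of f = (SOME A. bop_apply A = f)"

lemma bop_apply_bop_of: "bounded_clinear f \<Longrightarrow> bop_apply (bop_of f) = f"
  unfolding bop_of_def by (rule someI_ex) (rule bop_exists)

definition id_bop :: "'h::chilbert_space bop"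
  where "id_bop = bop_of (\<lambda>x. x)"

lemma bop_apply_id [simp]: "bop_apply id_bop x = x"
proof -
  have "bounded_clinear (\<lambda>x :: 'a. x)" by (simp add: bounded_clinear_def bounded_linear_ident)
  then show ?thesis unfolding id_bop_def by (simp add: bop_apply_bop_of)
qed

lemma id_bop_times [simp]: "id_bop * A = A" "A * id_bop = A"
  by (rule bop_eqI, simp add: bop_apply_simps)+

lemma tendsto_bop_apply:
  assumes "(X \<longlongrightarrow> A) F"
  shows "((\<lambda>n. bop_apply (X n) x) \<longlongrightarrow> bop_apply A x) F"
proof -
  have "((\<lambda>n. bop_apply (X n - A) x) \<longlongrightarrow> 0) F"
  proof (rule Lim_null_comparison)
    show "\<forall>\<^sub>F n in F. norm (bop_apply (X n - A) x) \<le> norm (X n - A) * norm x"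
      by (simp add: norm_bop_apply)
    show "((\<lambda>n. norm (X n - A) * norm x) \<longlongrightarrow> 0) F"
      by (intro tendsto_mult_left_zero tendsto_norm_zero) (use assms in \<open>simp add: LIM_zero\<close>)
  qed
  then show ?thesis by (simp add: bop_apply_diff_left LIM_zero_iff)
qed

lemma tendsto_cinner_right:
  assumes "(X \<longlongrightarrow> y) F"
  shows "((\<lambda>n. cinner x (X n)) \<longlongrightarrow> cinner x y) F"
proof -
  have "((\<lambda>n. cinner x (X n - y)) \<longlongrightarrow> 0) F"
  proof (rule Lim_null_comparison)
    show "\<forall>\<^sub>F n in F. norm (cinner x (X n - y)) \<le> norm x * norm (X n - y)"
      by (simp add: cinner_cauchy_schwarz)
    show "((\<lambda>n. norm x * norm (X n - y)) \<longlongrightarrow> 0) F"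
      by (intro tendsto_mult_right_zero tendsto_norm_zero) (use assms in \<open>simp add: LIM_zero\<close>)
  qed
  then show ?thesis by (simp add: cinner_diff_right LIM_zero_iff)
qed

lemma bop_eq_0_if_quadratic_form_0:
  assumes "\<And>x. cinner x (bop_apply D x) = 0"
  shows "D = 0"
proof (rule bop_eqI_cinner_right)
  fix x y
  have "cinner x (bop_apply D y) + cinner y (bop_apply D x) = 0"
    using assms[of "x + y"] assms[of x] assms[of y]
    by (simp add: bop_apply_simps cinner_simps add.commute)
  moreover have "\<i> * cinner x (bop_apply D y) - \<i> * cinner y (bop_apply D x) = 0"
    using assms[of "x + \<i> *\<^sub>C y"] assms[of x] assms[of y]
    by (simp add: bop_apply_simps cinner_simps)
  ultimately have "cinner x (bop_apply D y) = 0" by (simp add: algebra_simps)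
  then show "cinner x (bop_apply D y) = cinner x (bop_apply 0 y)" by simp
qed

lemma positive_op_star:
  assumes "positive_op A"
  shows "star A = A"
proof -
  have "star A - A = 0"
  proof (rule bop_eq_0_if_quadratic_form_0)
    fix x
    have "cinner x (bop_apply A x) \<in> \<real>"
      using assms unfolding positive_op_def by (intro nonnegative_complex_is_real) simp
    then have "cinner (bop_apply A x) x = cinner x (bop_apply A x)"
      by (subst cinner_commute) (simp add: Reals_cnj_iff)
    then show "cinner x (bop_apply (star A - A) x) = 0"
      by (simp add: bop_apply_simps cinner_simps cinner_star_right)
  qed
  then show ?thesis by simp
qed

lemma selfadjoint_cinner:
  "star A = A \<Longrightarrow> cinner (bop_apply A x) y = cinner x (bop_apply A y)"
  by (metis cinner_star_right)

lemma positive_op_Re: "positive_op A \<Longrightarrow> 0 \<le> Re (cinner x (bop_apply A x))"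
  by (simp add: positive_op_def less_eq_complex_def)

text \<open>The Cauchy-Schwarz inequality for the form \<open>\<langle>x, A y\<rangle>\<close>, at the vectors \<open>x\<close> and \<open>A x\<close>. It bounds the
  norm of \<open>A\<close> by its quadratic form, and gives \<open>A x = 0\<close> where that form vanishes.\<close>

lemma positive_op_norm_sq:
  assumes A: "positive_op A"
  shows "((norm (bop_apply A x))\<^sup>2)\<^sup>2
    \<le> Re (cinner x (bop_apply A x)) * Re (cinner (bop_apply A x) (bop_apply A (bop_apply A x)))"
proof -
  define y where "y = bop_apply A x"
  define a b c where "a = Re (cinner x y)" and "b = (norm y)\<^sup>2" and "c = Re (cinner y (bop_apply A y))"
  note sa = selfadjoint_cinner[OF positive_op_star[OF A]]
  have q: "0 \<le> a + 2 * t * b + t\<^sup>2 * c" for t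
  proof -
    have "0 \<le> Re (cinner (x + t *\<^sub>R y) (bop_apply A (x + t *\<^sub>R y)))"
      by (rule positive_op_Re[OF A])
    also have "\<dots> = a + t * Re (cinner x (bop_apply A y)) + t * Re (cinner y y) + t\<^sup>2 * c"
      by (simp add: bop_apply_simps cinner_simps a_def c_def y_def algebra_simps power2_eq_square)
    also have "cinner x (bop_apply A y) = cinner y y" by (simp add: y_def sa)
    finally show ?thesis by (simp add: b_def norm_sq_cinner)
  qed
  have c0: "0 \<le> c" unfolding c_def by (rule positive_op_Re[OF A])
  have b0: "0 \<le> b" by (simp add: b_def)
  have "b\<^sup>2 \<le> a * c"
  proof (cases "c = 0")
    case True
    have "b = 0"
    proof (rule ccontr)
      assume "b \<noteq> 0"
      then show False using q[of "- (a + 1) / (2 * b)"] True by (simp add: field_simps)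
    qed
    then show ?thesis using True by simp
  next
    case False
    have "0 \<le> (a + 2 * (- b / c) * b + (- b / c)\<^sup>2 * c) * c"
      using q[of "- b / c"] c0 by (rule mult_nonneg_nonneg)
    also have "\<dots> = a * c - b\<^sup>2" using False by (simp add: field_simps power2_eq_square)
    finally show ?thesis by simp
  qed
  then show ?thesis by (simp add: a_def b_def c_def y_def)
qed

lemma positive_op_apply_eq_0:
  assumes "positive_op A" "cinner x (bop_apply A x) = 0"
  shows "bop_apply A x = 0"
  using positive_op_norm_sq[OF assms(1), of x] assms(2) by simp

lemma positive_op_norm_le_1:
  assumes A: "positive_op A" and le: "\<And>x. Re (cinner x (bop_apply A x)) \<le> (norm x)\<^sup>2"
  shows "norm A \<le> 1"
proof (rule norm_bop_bound)
  fix x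
  let ?y = "bop_apply A x"
  have "((norm ?y)\<^sup>2)\<^sup>2 \<le> (norm x)\<^sup>2 * (norm ?y)\<^sup>2"
    by (rule order_trans[OF positive_op_norm_sq[OF A] mult_mono[OF le le]])
      (use positive_op_Re[OF A] in auto)
  then have "(norm ?y)\<^sup>2 \<le> (norm x)\<^sup>2"
    unfolding power2_eq_square[of "(norm ?y)\<^sup>2"]
    by (cases "?y = 0") (simp_all only: mult_le_cancel_right, simp_all)
  then show "norm ?y \<le> 1 * norm x" by simp
qed simp

text \<open>The fixed points \<open>Y = (B + Y\<^sup>2) / 2\<close> of this recursion are the solutions of
  \<open>(1 - Y)\<^sup>2 = 1 - B\<close>, written without reference to a unit.\<close>

primrec sqrt_iter :: "'a::real_normed_algebra \<Rightarrow> nat \<Rightarrow> 'a" where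
  "sqrt_iter B 0 = 0"
| "sqrt_iter B (Suc n) = (1/2) *\<^sub>R (B + sqrt_iter B n * sqrt_iter B n)"

lemma sqrt_iter_real_mono:
  "0 \<le> sqrt_iter (1::real) n \<and> sqrt_iter (1::real) n \<le> sqrt_iter 1 (Suc n) \<and> sqrt_iter (1::real) n \<le> 1"
proof (induction n)
  case (Suc n)
  then have "sqrt_iter (1::real) n * sqrt_iter 1 n \<le> sqrt_iter 1 (Suc n) * sqrt_iter 1 (Suc n)"
    by (intro mult_mono) auto
  moreover have "sqrt_iter (1::real) n * sqrt_iter 1 n \<le> 1"
    using Suc by (intro mult_le_one) auto
  ultimately show ?case by simp
qed simp

text \<open>The iterates and their increments are polynomials in \<open>B\<close> with nonnegative coefficients, so the
  scalar iteration at \<open>1\<close> majorizes the iteration at any \<open>B\<close> in the unit ball. This gives norm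
  convergence even for \<open>\<parallel>B\<parallel> = 1\<close>, on the boundary of the disc of convergence of the power series of
  \<open>1 - sqrt (1 - z)\<close>.\<close>

lemma sqrt_iter_majorant:
  fixes B :: "'a::real_normed_algebra"
  assumes "norm B \<le> 1"
  shows "norm (sqrt_iter B n) \<le> sqrt_iter 1 n"
    and "norm (sqrt_iter B (Suc n) - sqrt_iter B n) \<le> sqrt_iter 1 (Suc n) - sqrt_iter 1 n"
proof -
  show le: "norm (sqrt_iter B n) \<le> sqrt_iter 1 n" for n
  proof (induction n)
    case (Suc n)
    have "norm (sqrt_iter B n * sqrt_iter B n) \<le> sqrt_iter 1 n * sqrt_iter 1 n"
      by (rule order_trans[OF norm_mult_ineq mult_mono[OF Suc Suc]])
        (use sqrt_iter_real_mono[of n] in auto)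
    then show ?case
      using assms norm_triangle_ineq[of B "sqrt_iter B n * sqrt_iter B n"] by simp
  qed simp
  show "norm (sqrt_iter B (Suc n) - sqrt_iter B n) \<le> sqrt_iter 1 (Suc n) - sqrt_iter 1 n"
  proof (induction n)
    case 0
    then show ?case using assms by simp
  next
    case (Suc n)
    define u v a b where "u = sqrt_iter B n" and "v = sqrt_iter B (Suc n)"
      and "a = sqrt_iter (1::real) n" and "b = sqrt_iter (1::real) (Suc n)"
    have IH: "norm (v - u) \<le> b - a" using Suc by (simp only: u_def v_def a_def b_def)
    have u: "norm u \<le> a" and v: "norm v \<le> b" using le unfolding u_def v_def a_def b_def by blast+
    have a0: "0 \<le> a" and b0: "0 \<le> b" using sqrt_iter_real_mono unfolding a_def b_def by blast+
    have "norm (v * v - u * u) = norm (v * (v - u) + (v - u) * u)"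
      by (simp add: algebra_simps)
    also have "\<dots> \<le> norm v * norm (v - u) + norm (v - u) * norm u"
      by (rule order_trans[OF norm_triangle_ineq add_mono[OF norm_mult_ineq norm_mult_ineq]])
    also have "\<dots> \<le> b * (b - a) + (b - a) * a"
      using IH u v a0 b0 order_trans[OF norm_ge_zero IH] by (intro add_mono mult_mono) auto
    also have "\<dots> = b * b - a * a" by (simp add: algebra_simps)
    finally have "norm ((1/2) *\<^sub>R (v * v - u * u)) \<le> (b * b - a * a) / 2" by simp
    moreover have "sqrt_iter B (Suc (Suc n)) - sqrt_iter B (Suc n) = (1/2) *\<^sub>R (v * v - u * u)"
      by (simp only: sqrt_iter.simps(2)[of B "Suc n"] v_def[symmetric])
        (simp only: v_def u_def sqrt_iter.simps(2)[of B n] scaleR_diff_right[symmetric] add_diff_cancel_left)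
    moreover have "sqrt_iter 1 (Suc (Suc n)) - sqrt_iter 1 (Suc n) = (b * b - a * a) / 2"
      by (simp only: sqrt_iter.simps(2)[of "1::real" "Suc n"] b_def[symmetric])
        (simp add: b_def a_def field_simps)
    ultimately show ?case by simp
  qed
qed

lemma sqrt_iter_convergent:
  fixes B :: "'a::{real_normed_algebra, banach}"
  assumes B: "norm B \<le> 1"
  obtains Y where "sqrt_iter B \<longlonglongrightarrow> Y" "B + Y * Y = 2 *\<^sub>R Y"
proof -
  let ?y = "sqrt_iter (1::real)"
  have inc: "incseq ?y" using sqrt_iter_real_mono by (intro incseq_SucI) blast
  have "convergent ?y"
    using inc sqrt_iter_real_mono by (metis incseq_convergent convergentI)
  then have Cy: "Cauchy ?y" by (rule convergent_Cauchy)
  have diff: "norm (sqrt_iter B n - sqrt_iter B m) \<le> ?y n - ?y m" if "m \<le> n" for m n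
    using that
  proof (induction n rule: dec_induct)
    case (step n)
    then show ?case
      using norm_triangle_ineq[of "sqrt_iter B (Suc n) - sqrt_iter B n" "sqrt_iter B n - sqrt_iter B m"]
        sqrt_iter_majorant(2)[OF B, of n] by (simp del: sqrt_iter.simps)
  qed simp
  have "Cauchy (sqrt_iter B)"
    unfolding Cauchy_altdef
  proof (intro allI impI)
    fix e :: real assume "0 < e"
    then obtain M where M: "\<And>m n. m \<ge> M \<Longrightarrow> n > m \<Longrightarrow> dist (?y m) (?y n) < e"
      using Cy unfolding Cauchy_altdef by metis
    have "dist (sqrt_iter B m) (sqrt_iter B n) < e" if "m \<ge> M" "n > m" for m n
      using M[OF that] diff[of m n] that by (simp add: dist_norm norm_minus_commute)
    then show "\<exists>M. \<forall>m\<ge>M. \<forall>n>m. dist (sqrt_iter B m) (sqrt_iter B n) < e" by blast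
  qed
  then obtain Y where Y: "sqrt_iter B \<longlonglongrightarrow> Y" using Cauchy_convergent convergent_def by blast
  have "(\<lambda>n. sqrt_iter B (Suc n)) \<longlonglongrightarrow> (1/2) *\<^sub>R (B + Y * Y)"
    unfolding sqrt_iter.simps by (intro tendsto_intros Y)
  then have "(1/2) *\<^sub>R (B + Y * Y) = Y" using LIMSEQ_Suc[OF Y] LIMSEQ_unique by blast
  then have "2 *\<^sub>R Y = 2 *\<^sub>R (1/2) *\<^sub>R (B + Y * Y)" by simp
  then show ?thesis using that[OF Y] by simp
qed

text \<open>After rescaling, \<open>0 \<le> A \<le> 1\<close>, so \<open>B = 1 - A\<close> lies in the unit ball and \<open>S = 1 - Y\<close> for the limit \<open>Y\<close>
  of the iteration. As \<open>\<parallel>Y\<parallel> \<le> 1\<close>, \<open>S\<close> is positive. Whatever commutes with \<open>A\<close> commutes with all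
  iterates, hence with \<open>S\<close>; the uniqueness of the square root depends on this.\<close>

lemma positive_sqrt_exists:
  assumes A: "positive_op A"
  obtains S where "positive_op S" "S * S = A" "\<And>D. D * A = A * D \<Longrightarrow> D * S = S * D"
proof -
  have main: "\<exists>S. positive_op S \<and> S * S = A \<and> (\<forall>D. D * A = A * D \<longrightarrow> D * S = S * D)"
    if A: "positive_op A" and nA: "norm A \<le> 1" for A :: "'a bop"
  proof -
    define B where "B = id_bop - A"
    have B_form: "cinner x (bop_apply B x) = (norm x)\<^sup>2 - cinner x (bop_apply A x)" for x
      by (simp add: B_def bop_apply_simps cinner_simps cinner_self)
    have "Re (cinner x (bop_apply A x)) \<le> (norm x)\<^sup>2" for x
    proof -
      have "Re (cinner x (bop_apply A x)) \<le> norm x * norm (bop_apply A x)"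
        using complex_Re_le_cmod cinner_cauchy_schwarz order_trans by blast
      also have "\<dots> \<le> norm x * (norm A * norm x)"
        by (intro mult_left_mono norm_bop_apply) simp
      also have "\<dots> \<le> norm x * norm x"
        using nA by (intro mult_left_mono) (auto simp: mult_left_le_one_le)
      finally show ?thesis by (simp add: power2_eq_square)
    qed
    then have "positive_op B"
      using A unfolding positive_op_def B_form less_eq_complex_def by simp
    moreover have "Re (cinner x (bop_apply B x)) \<le> (norm x)\<^sup>2" for x
      using positive_op_Re[OF A, of x] by (simp add: B_form)
    ultimately have saB: "star B = B" and nB: "norm B \<le> 1"
      by (auto intro: positive_op_star positive_op_norm_le_1)
    obtain Y where Y: "sqrt_iter B \<longlonglongrightarrow> Y" and YY: "B + Y * Y = 2 *\<^sub>R Y"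
      using sqrt_iter_convergent[OF nB] by blast
    define S where "S = id_bop - Y"
    have sa_iter: "star (sqrt_iter B n) = sqrt_iter B n" for n
    proof (induction n)
      case 0
      show ?case using star_add[of 0 "0 :: 'a bop"] by simp
    next
      case (Suc n)
      then show ?case
        by (simp add: scaleC_of_real[symmetric] star_scaleC star_add star_mult saB)
    qed
    have nY: "norm (sqrt_iter B n) \<le> 1" for n
      using sqrt_iter_majorant(1)[OF nB, of n] sqrt_iter_real_mono[of n] by linarith
    have S_form: "(\<lambda>n. cinner x (bop_apply (id_bop - sqrt_iter B n) x)) \<longlonglongrightarrow> cinner x (bop_apply S x)"
      for x unfolding S_def by (intro tendsto_cinner_right tendsto_bop_apply tendsto_intros Y)
    have iter_form: "0 \<le> cinner x (bop_apply (id_bop - sqrt_iter B n) x)" for x n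
    proof -
      have "cmod (cinner x (bop_apply (sqrt_iter B n) x)) \<le> norm x * norm (bop_apply (sqrt_iter B n) x)"
        by (rule cinner_cauchy_schwarz)
      also have "\<dots> \<le> norm x * (norm (sqrt_iter B n) * norm x)"
        by (intro mult_left_mono norm_bop_apply) simp
      also have "\<dots> \<le> norm x * norm x"
        using nY[of n] by (intro mult_left_mono) (auto simp: mult_left_le_one_le)
      finally have "Re (cinner x (bop_apply (sqrt_iter B n) x)) \<le> (norm x)\<^sup>2"
        using complex_Re_le_cmod order_trans by (fastforce simp: power2_eq_square)
      moreover have "Im (cinner x (bop_apply (sqrt_iter B n) x)) = 0"
        using selfadjoint_cinner[OF sa_iter, of n x x] cinner_commute[of x "bop_apply (sqrt_iter B n) x"]
        by (metis Reals_cnj_iff complex_is_Real_iff)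
      ultimately show ?thesis
        by (simp add: bop_apply_simps cinner_simps cinner_self less_eq_complex_def)
    qed
    have "0 \<le> Re (cinner x (bop_apply S x)) \<and> Im (cinner x (bop_apply S x)) = 0" for x
    proof
      show "0 \<le> Re (cinner x (bop_apply S x))"
        using iter_form by (intro tendsto_lowerbound[OF tendsto_Re[OF S_form[of x]]])
          (simp_all add: less_eq_complex_def)
      have "(\<lambda>n. 0) \<longlonglongrightarrow> Im (cinner x (bop_apply S x))"
        using tendsto_Im[OF S_form[of x]] iter_form by (simp add: less_eq_complex_def)
      then show "Im (cinner x (bop_apply S x)) = 0" by (metis LIMSEQ_unique tendsto_const)
    qed
    then have "positive_op S" by (simp add: positive_op_def less_eq_complex_def)
    moreover have "S * S = A"
    proof -
      have "S * S = id_bop - 2 *\<^sub>R Y + Y * Y"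
        by (simp add: S_def algebra_simps scaleR_2)
      also have "\<dots> = A" using YY by (simp add: B_def algebra_simps)
      finally show ?thesis .
    qed
    moreover have "D * S = S * D" if "D * A = A * D" for D
    proof -
      have DB: "D * B = B * D" using that by (simp add: B_def algebra_simps)
      have Dn: "D * sqrt_iter B n = sqrt_iter B n * D" for n
      proof (induction n)
        case (Suc n)
        then have "D * (sqrt_iter B n * sqrt_iter B n) = sqrt_iter B n * sqrt_iter B n * D"
          by (metis mult.assoc)
        then show ?case using DB by (simp add: algebra_simps)
      qed simp
      have "(\<lambda>n. D * sqrt_iter B n) \<longlonglongrightarrow> D * Y" "(\<lambda>n. sqrt_iter B n * D) \<longlonglongrightarrow> Y * D"
        by (intro tendsto_intros Y)+
      then have "D * Y = Y * D" unfolding Dn by (rule LIMSEQ_unique)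
      then show ?thesis by (simp add: S_def algebra_simps)
    qed
    ultimately show ?thesis by blast
  qed
  show ?thesis
  proof (cases "A = 0")
    case True
    then show ?thesis using that[of 0] by (simp add: positive_op_def)
  next
    case False
    define c where "c = norm A"
    have c: "0 < c" using False by (simp add: c_def)
    have "positive_op ((1/c) *\<^sub>R A)"
      using A c unfolding positive_op_def
      by (auto simp: bop_apply_simps cinner_simps less_eq_complex_def)
    moreover have "norm ((1/c) *\<^sub>R A) \<le> 1" using c by (simp add: c_def)
    ultimately obtain S where S: "positive_op S" "S * S = (1/c) *\<^sub>R A"
      "\<And>D. D * ((1/c) *\<^sub>R A) = ((1/c) *\<^sub>R A) * D \<Longrightarrow> D * S = S * D"
      using main by blast
    show ?thesis
    proof (rule that[of "sqrt c *\<^sub>R S"])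
      show "positive_op (sqrt c *\<^sub>R S)"
        using S(1) c unfolding positive_op_def
        by (auto simp: bop_apply_simps cinner_simps less_eq_complex_def)
      show "sqrt c *\<^sub>R S * sqrt c *\<^sub>R S = A" using S(2) c by simp
      show "D * sqrt c *\<^sub>R S = sqrt c *\<^sub>R S * D" if "D * A = A * D" for D
        using S(3)[of D] that by simp
    qed
  qed
qed

text \<open>With \<open>D = P - Q\<close> one has \<open>P D + D Q = 0\<close> and, taking adjoints, \<open>D P + Q D = 0\<close>. Hence
  \<open>D P D = - D\<^sup>2 Q = - Q D\<^sup>2\<close>, and if \<open>R\<close> is the square root of \<open>Q\<close>, which commutes with \<open>D\<^sup>2\<close>, the
  two positive operators \<open>D P D\<close> and \<open>R D\<^sup>2 R\<close> add up to zero. So both vanish, whence \<open>P D = 0\<close>,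
  \<open>Q D = 0\<close> and \<open>D\<^sup>2 = 0\<close>.\<close>

lemma positive_sqrt_unique:
  assumes P: "positive_op P" and Q: "positive_op Q" and eq: "P * P = Q * Q"
  shows "P = Q"
proof -
  define D where "D = P - Q"
  note saP = positive_op_star[OF P] and saQ = positive_op_star[OF Q]
  have minus: "D = P + (-1) *\<^sub>C Q"
    using scaleC_of_real[of "-1" Q] by (simp add: D_def)
  have saD: "star D = D"
    unfolding minus by (simp add: star_add star_scaleC saP saQ)
  obtain R where R: "positive_op R" "R * R = Q" and
    Rcomm: "\<And>X. X * Q = Q * X \<Longrightarrow> X * R = R * X"
    using positive_sqrt_exists[OF Q] by blast
  note cP = selfadjoint_cinner[OF saP] and cQ = selfadjoint_cinner[OF saQ]
    and cD = selfadjoint_cinner[OF saD] and cR = selfadjoint_cinner[OF positive_op_star[OF R(1)]]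
  have 1: "P * D + D * Q = 0" and 2: "Q * D + D * P = 0"
    by (simp_all add: D_def algebra_simps eq)
  have 3: "D * P * D + D * D * Q = 0"
    using arg_cong[OF 1, of "\<lambda>X. D * X"] by (simp add: algebra_simps)
  have 4: "D * P * D + Q * D * D = 0"
    using arg_cong[OF 2, of "\<lambda>X. X * D"] by (simp add: algebra_simps)
  have "D * D * Q = Q * (D * D)" using 3 4 by (metis add_left_cancel mult.assoc)
  then have comm: "D * D * R = R * (D * D)" by (rule Rcomm)
  have "D * P * D + R * (D * D) * R = 0"
    using 3 by (simp add: R(2)[symmetric] comm[symmetric] mult.assoc)
  then have zero: "cinner (bop_apply D x) (bop_apply P (bop_apply D x))
      + of_real ((norm (bop_apply D (bop_apply R x)))\<^sup>2) = 0" for x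
  proof -
    assume "D * P * D + R * (D * D) * R = 0"
    then have "cinner x (bop_apply (D * P * D + R * (D * D) * R) x) = 0" by simp
    then show ?thesis
      by (simp add: bop_apply_simps cinner_simps cD[symmetric] cR[symmetric] cinner_self)
  qed
  have DR: "bop_apply D (bop_apply R x) = 0" and PD: "bop_apply P (bop_apply D x) = 0" for x
  proof -
    have "Re (cinner (bop_apply D x) (bop_apply P (bop_apply D x)))
      + (norm (bop_apply D (bop_apply R x)))\<^sup>2 = 0"
      using arg_cong[OF zero[of x], of Re] by simp
    then show "bop_apply D (bop_apply R x) = 0"
      using positive_op_Re[OF P, of "bop_apply D x"]
        zero_le_power2[of "norm (bop_apply D (bop_apply R x))"] by (simp add: add_nonneg_eq_0_iff)
    then show "bop_apply P (bop_apply D x) = 0"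
      using zero[of x] by (intro positive_op_apply_eq_0[OF P]) simp
  qed
  have QD: "bop_apply Q (bop_apply D x) = 0" for x
  proof (rule cinner_ext)
    fix z
    have "cinner z (bop_apply Q (bop_apply D x)) = cinner (bop_apply D (bop_apply Q z)) x"
      by (simp add: cD cQ)
    also have "bop_apply D (bop_apply Q z) = 0"
      by (simp add: R(2)[symmetric] bop_apply_times DR)
    finally show "cinner z (bop_apply Q (bop_apply D x)) = cinner z 0" by simp
  qed
  have "bop_apply D x = 0" for x
  proof -
    have "bop_apply D (bop_apply D x) = 0"
      using PD[of x] QD[of x] by (subst (1) D_def) (simp add: bop_apply_diff_left)
    then have "cinner (bop_apply D x) (bop_apply D x) = 0" by (simp add: cD)
    then show ?thesis by (simp add: cinner_self)
  qed
  then have "bop_apply P x = bop_apply Q x" for x by (simp add: D_def bop_apply_diff_left)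
  then show ?thesis by (rule bop_eqI)
qed

section \<open>Positive matrices of operators\<close>

instantiation vec :: (complex_normed_vector, finite) complex_normed_vector
begin

definition scaleC_vec :: "complex \<Rightarrow> 'a^'b \<Rightarrow> 'a^'b"
  where "scaleC_vec c x = (\<chi> i. c *\<^sub>C x $ i)"

instance
proof
  fix c d :: complex and r :: real and x y :: "'a^'b"
  show "c *\<^sub>C (x + y) = c *\<^sub>C x + c *\<^sub>C y" "(c + d) *\<^sub>C x = c *\<^sub>C x + d *\<^sub>C x"
    "c *\<^sub>C d *\<^sub>C x = (c * d) *\<^sub>C x" "complex_of_real r *\<^sub>C x = r *\<^sub>R x"
    by (simp_all add: vec_eq_iff scaleC_vec_def scaleC_add_right scaleC_add_left scaleC_scaleC
        scaleC_of_real)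
  show "norm (c *\<^sub>C x) = cmod c * norm x"
    by (simp add: norm_vec_def scaleC_vec_def norm_scaleC L2_set_right_distrib)
qed

end

instantiation vec :: (chilbert_space, finite) chilbert_space
begin

definition cinner_vec :: "'a^'b \<Rightarrow> 'a^'b \<Rightarrow> complex"
  where "cinner_vec x y = (\<Sum>i\<in>UNIV. cinner (x $ i) (y $ i))"

instance
proof
  fix c :: complex and x y z :: "'a^'b"
  show "cinner x y = cnj (cinner y x)"
    unfolding cinner_vec_def cnj_sum by (intro sum.cong refl) (rule cinner_commute)
  show "cinner x (y + z) = cinner x y + cinner x z"
    by (simp add: cinner_vec_def cinner_add_right sum.distrib)
  show "cinner x (c *\<^sub>C y) = c * cinner x y"
    by (simp add: cinner_vec_def scaleC_vec_def cinner_scaleC_right sum_distrib_left)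
  show "cinner x x = complex_of_real ((norm x)\<^sup>2)"
    by (simp add: cinner_vec_def norm_vec_def L2_set_def cinner_self sum_nonneg)
qed

end

lemma scaleC_vec_nth [simp]: "(c *\<^sub>C x) $ i = c *\<^sub>C x $ i"
  by (simp add: scaleC_vec_def)

lemma cinner_axis_left: "cinner (axis i x) \<xi> = cinner x (\<xi> $ i)"
proof -
  have "cinner (axis i x) \<xi> = (\<Sum>j\<in>UNIV. if j = i then cinner x (\<xi> $ i) else 0)"
    unfolding cinner_vec_def by (intro sum.cong refl) (auto simp: axis_def)
  then show ?thesis by simp
qed

lemma norm_axis_eq: "norm (axis i x :: 'h::chilbert_space^'k) = norm x"
proof -
  have "(norm (axis i x :: 'h^'k))\<^sup>2 = (norm x)\<^sup>2"
    unfolding norm_sq_cinner cinner_axis_left by simp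
  then show ?thesis by simp
qed

definition op_of_mat :: "'h::chilbert_space bop^'k^'k \<Rightarrow> ('h^'k) bop"
  where "op_of_mat R = bop_of (\<lambda>\<xi>. \<chi> i. \<Sum>j\<in>UNIV. bop_apply (R $ i $ j) (\<xi> $ j))"

lemma bop_apply_op_of_mat:
  "bop_apply (op_of_mat R) \<xi> = (\<chi> i. \<Sum>j\<in>UNIV. bop_apply (R $ i $ j) (\<xi> $ j))"
proof -
  have "bounded_clinear (\<lambda>\<xi> :: 'a^'b. \<chi> i. \<Sum>j\<in>UNIV. bop_apply (R $ i $ j) (\<xi> $ j))"
    unfolding bounded_clinear_def
  proof (intro conjI allI)
    show "bounded_linear (\<lambda>\<xi> :: 'a^'b. \<chi> i. \<Sum>j\<in>UNIV. bop_apply (R $ i $ j) (\<xi> $ j))"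
    proof (rule bounded_linear_intro[where K="\<Sum>i\<in>UNIV. \<Sum>j\<in>UNIV. norm (R $ i $ j)"])
      fix \<xi> :: "'a^'b"
      have "norm (\<chi> i. \<Sum>j\<in>UNIV. bop_apply (R $ i $ j) (\<xi> $ j))
          \<le> (\<Sum>i\<in>UNIV. norm (\<Sum>j\<in>UNIV. bop_apply (R $ i $ j) (\<xi> $ j)))"
        unfolding norm_vec_def by (rule order_trans[OF L2_set_le_sum]) simp_all
      also have "\<dots> \<le> (\<Sum>i\<in>UNIV. \<Sum>j\<in>UNIV. norm (R $ i $ j) * norm \<xi>)"
        by (intro sum_mono sum_norm_le)
          (rule order_trans[OF norm_bop_apply mult_left_mono[OF Finite_Cartesian_Product.norm_nth_le norm_ge_zero]])
      finally show "norm (\<chi> i. \<Sum>j\<in>UNIV. bop_apply (R $ i $ j) (\<xi> $ j))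
          \<le> norm \<xi> * (\<Sum>i\<in>UNIV. \<Sum>j\<in>UNIV. norm (R $ i $ j))"
        by (simp add: sum_distrib_left mult.commute)
    qed (simp_all add: vec_eq_iff bop_apply_simps sum.distrib scaleR_sum_right)
    show "(\<chi> i. \<Sum>j\<in>UNIV. bop_apply (R $ i $ j) ((c *\<^sub>C \<xi>) $ j))
        = c *\<^sub>C (\<chi> i. \<Sum>j\<in>UNIV. bop_apply (R $ i $ j) (\<xi> $ j))" for c and \<xi> :: "'a^'b"
      by (simp add: vec_eq_iff bop_apply_scaleC
          linear_sum[OF bounded_linear.linear[OF bounded_linear_scaleC]])
  qed
  then show ?thesis unfolding op_of_mat_def by (simp add: bop_apply_bop_of)
qed

definition mat_of_op :: "('h::chilbert_space^'k) bop \<Rightarrow> 'h bop^'k^'k"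
  where "mat_of_op S = (\<chi> i j. bop_of (\<lambda>x. bop_apply S (axis j x) $ i))"

lemma bop_apply_mat_of_op:
  "bop_apply (mat_of_op S $ i $ j) x = bop_apply S (axis j x) $ i"
proof -
  have axis: "axis j (x + y) = axis j x + axis j y" "axis j (r *\<^sub>R x) = r *\<^sub>R axis j x"
    "axis j (c *\<^sub>C x) = c *\<^sub>C axis j x" for x y :: 'a and r c and j :: 'b
    by (simp_all add: vec_eq_iff axis_def)
  have "bounded_clinear (\<lambda>x. bop_apply S (axis j x) $ i)"
    unfolding bounded_clinear_def
  proof (intro conjI allI)
    show "bounded_linear (\<lambda>x. bop_apply S (axis j x) $ i)"
    proof (rule bounded_linear_intro[where K="norm S"])
      show "norm (bop_apply S (axis j x) $ i) \<le> norm x * norm S" for x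
        using order_trans[OF Finite_Cartesian_Product.norm_nth_le[of _ i] norm_bop_apply[of S "axis j x"]]
        by (simp add: norm_axis_eq mult.commute)
    qed (simp_all add: axis bop_apply_simps)
    show "bop_apply S (axis j (c *\<^sub>C x)) $ i = c *\<^sub>C bop_apply S (axis j x) $ i" for c x
      by (simp add: axis bop_apply_simps)
  qed
  then show ?thesis unfolding mat_of_op_def by (simp add: bop_apply_bop_of)
qed

lemma cinner_op_of_mat:
  "cinner \<xi> (bop_apply (op_of_mat R) \<xi>) =
    (\<Sum>i\<in>UNIV. \<Sum>j\<in>UNIV. cinner (\<xi> $ i) (bop_apply (R $ i $ j) (\<xi> $ j)))"
  by (simp add: cinner_vec_def bop_apply_op_of_mat cinner_sum_right)

lemma mat_mult_star_nth:
  "mat_mult (mat_star B) B $ i $ j = (\<Sum>l\<in>UNIV. star (B $ l $ i) * B $ l $ j)"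
  by (simp add: mat_mult_def mat_star_def)

text \<open>This is where \<open>M\<^sub>k(\<B>(\<H>))\<close> is identified with \<open>\<B>(\<H>\<^sup>k)\<close>: the square root of
  a positive operator on \<open>\<H>\<^sup>k\<close>, read as a matrix, provides the factor \<open>B\<close> in \<open>B\<^sup>* B\<close>.\<close>

lemma mat_positive_iff:
  fixes R :: "'h::chilbert_space bop^'k^'k"
  shows "mat_positive R \<longleftrightarrow>
    (\<forall>\<xi> :: 'h^'k. 0 \<le> (\<Sum>i\<in>UNIV. \<Sum>j\<in>UNIV. cinner (\<xi> $ i) (bop_apply (R $ i $ j) (\<xi> $ j))))"
proof
  assume "mat_positive R"
  then obtain B where B: "R = mat_mult (mat_star B) B" unfolding mat_positive_def by blast
  show "\<forall>\<xi> :: 'h^'k. 0 \<le> (\<Sum>i\<in>UNIV. \<Sum>j\<in>UNIV. cinner (\<xi> $ i) (bop_apply (R $ i $ j) (\<xi> $ j)))"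
  proof
    fix \<xi> :: "'h^'k"
    have "(\<Sum>i\<in>UNIV. \<Sum>j\<in>UNIV. cinner (\<xi> $ i) (bop_apply (R $ i $ j) (\<xi> $ j)))
        = cinner (bop_apply (op_of_mat B) \<xi>) (bop_apply (op_of_mat B) \<xi>)"
    proof -
      have "cinner (bop_apply (op_of_mat B) \<xi>) (bop_apply (op_of_mat B) \<xi>)
          = (\<Sum>l\<in>UNIV. \<Sum>i\<in>UNIV. \<Sum>j\<in>UNIV.
              cinner (bop_apply (B $ l $ i) (\<xi> $ i)) (bop_apply (B $ l $ j) (\<xi> $ j)))"
        unfolding cinner_vec_def bop_apply_op_of_mat vec_lambda_beta cinner_sum_left
        by (simp only: cinner_sum_right)
      also have "\<dots> = (\<Sum>i\<in>UNIV. \<Sum>l\<in>UNIV. \<Sum>j\<in>UNIV.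
              cinner (bop_apply (B $ l $ i) (\<xi> $ i)) (bop_apply (B $ l $ j) (\<xi> $ j)))"
        by (rule sum.swap)
      also have "\<dots> = (\<Sum>i\<in>UNIV. \<Sum>j\<in>UNIV. \<Sum>l\<in>UNIV.
              cinner (bop_apply (B $ l $ i) (\<xi> $ i)) (bop_apply (B $ l $ j) (\<xi> $ j)))"
        by (rule sum.cong[OF refl]) (rule sum.swap)
      finally show ?thesis
        by (simp add: B mat_mult_star_nth bop_apply_sum_left bop_apply_times cinner_sum_right
            cinner_star_right)
    qed
    then show "0 \<le> (\<Sum>i\<in>UNIV. \<Sum>j\<in>UNIV. cinner (\<xi> $ i) (bop_apply (R $ i $ j) (\<xi> $ j)))"
      by (simp only: cinner_self_ge_0)
  qed
next
  assume "\<forall>\<xi> :: 'h^'k. 0 \<le> (\<Sum>i\<in>UNIV. \<Sum>j\<in>UNIV. cinner (\<xi> $ i) (bop_apply (R $ i $ j) (\<xi> $ j)))"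
  then have "positive_op (op_of_mat R)" by (simp add: positive_op_def cinner_op_of_mat)
  then obtain S where S: "positive_op S" "S * S = op_of_mat R" by (rule positive_sqrt_exists)
  have "R = mat_mult (mat_star (mat_of_op S)) (mat_of_op S)"
  proof -
    have "R $ i $ j = mat_mult (mat_star (mat_of_op S)) (mat_of_op S) $ i $ j" for i j
    proof (rule bop_eqI_cinner_right)
      fix x y
      have "cinner x (bop_apply (mat_mult (mat_star (mat_of_op S)) (mat_of_op S) $ i $ j) y)
          = cinner (bop_apply S (axis i x)) (bop_apply S (axis j y))"
        by (simp add: mat_mult_star_nth bop_apply_sum_left bop_apply_times cinner_sum_right
            cinner_star_right bop_apply_mat_of_op cinner_vec_def)
      also have "\<dots> = cinner (axis i x) (bop_apply (op_of_mat R) (axis j y))"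
        by (simp add: selfadjoint_cinner[OF positive_op_star[OF S(1)]] S(2)[symmetric] bop_apply_times)
      also have "\<dots> = cinner x (\<Sum>l\<in>UNIV. bop_apply (R $ i $ l) (axis j y $ l))"
        by (simp add: cinner_axis_left bop_apply_op_of_mat)
      also have "(\<Sum>l\<in>UNIV. bop_apply (R $ i $ l) (axis j y $ l))
          = (\<Sum>l\<in>UNIV. if l = j then bop_apply (R $ i $ j) y else 0)"
        by (intro sum.cong refl) (auto simp: axis_def bop_apply_simps)
      finally show "cinner x (bop_apply (R $ i $ j) y)
          = cinner x (bop_apply (mat_mult (mat_star (mat_of_op S)) (mat_of_op S) $ i $ j) y)"
        by simp
    qed
    then show ?thesis by (simp add: vec_eq_iff)
  qed
  then show "mat_positive R" unfolding mat_positive_def by blast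
qed

section \<open>Hilbert-Schmidt operators\<close>

lemma has_sum_finite_sum:
  fixes f :: "'i \<Rightarrow> 'a \<Rightarrow> 'b::topological_comm_monoid_add"
  assumes "\<And>i. i \<in> I \<Longrightarrow> (f i has_sum s i) A"
  shows "((\<lambda>x. \<Sum>i\<in>I. f i x) has_sum (\<Sum>i\<in>I. s i)) A"
  using assms
proof (induction I rule: infinite_finite_induct)
  case (insert i I)
  then show ?case by (simp add: has_sum_add)
qed simp_all

lemma has_sum_nonneg_complex:
  fixes s :: complex
  assumes "(f has_sum s) A" "\<And>x. 0 \<le> f x"
  shows "0 \<le> s"
  using infsum_nonneg_complex[OF has_sum_imp_summable[OF assms(1)]] assms(2) infsumI[OF assms(1)]
  by simp

lemma sum_swap_pairs:
  "(\<Sum>i\<in>A. \<Sum>j\<in>B. \<Sum>l\<in>C. \<Sum>m\<in>D. f i j l m) = (\<Sum>l\<in>C. \<Sum>m\<in>D. \<Sum>i\<in>A. \<Sum>j\<in>B. f i j l m)"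
  for f :: "_ \<Rightarrow> _ \<Rightarrow> _ \<Rightarrow> _ \<Rightarrow> 'c::comm_monoid_add"
proof -
  have "(\<Sum>p\<in>A \<times> B. \<Sum>q\<in>C \<times> D. f (fst p) (snd p) (fst q) (snd q))
      = (\<Sum>q\<in>C \<times> D. \<Sum>p\<in>A \<times> B. f (fst p) (snd p) (fst q) (snd q))"
    by (rule sum.swap)
  then show ?thesis by (simp add: sum.cartesian_product')
qed

definition hilbert_schmidt :: "'h::chilbert_space bop \<Rightarrow> bool"
  where "hilbert_schmidt X \<longleftrightarrow> (\<exists>F. is_onb F \<and> (\<lambda>e. (norm (bop_apply X e))\<^sup>2) summable_on F)"

text \<open>Parseval's identity in \<open>F\<close> followed by Bessel's inequality in \<open>F'\<close>, with only finitely many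
  vectors of \<open>F'\<close> in play, so that no double series has to be rearranged. Applied back and forth,
  the inequality becomes an equality.\<close>

lemma hilbert_schmidt_star_le:
  assumes F: "is_onb F" and F': "is_onb F'" and X: "((\<lambda>e. (norm (bop_apply X e))\<^sup>2) has_sum s) F"
  obtains t where "((\<lambda>e. (norm (bop_apply (star X) e))\<^sup>2) has_sum t) F'" "t \<le> s"
proof -
  have le: "(\<Sum>g\<in>G. (norm (bop_apply (star X) g))\<^sup>2) \<le> s" if G: "finite G" "G \<subseteq> F'" for G
  proof (rule has_sum_mono[OF _ X])
    show "((\<lambda>e. \<Sum>g\<in>G. (cmod (cinner e (bop_apply (star X) g)))\<^sup>2) has_sum
        (\<Sum>g\<in>G. (norm (bop_apply (star X) g))\<^sup>2)) F"
      by (intro has_sum_finite_sum parseval_norm F)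
    show "(\<Sum>g\<in>G. (cmod (cinner e (bop_apply (star X) g)))\<^sup>2) \<le> (norm (bop_apply X e))\<^sup>2" for e
      using bessel[OF F' G, of "bop_apply X e"]
      by (simp add: cinner_star_right cmod_cinner_commute[of "bop_apply X e"])
  qed
  have "(\<lambda>e. (norm (bop_apply (star X) e))\<^sup>2) summable_on F'"
    using le by (intro nonneg_bdd_above_summable_on bdd_aboveI2[where M=s]) auto
  then obtain t where t: "((\<lambda>e. (norm (bop_apply (star X) e))\<^sup>2) has_sum t) F'"
    by (auto simp: summable_on_def)
  then show ?thesis using has_sum_le_finite_sums[OF t le] that by blast
qed

lemma hilbert_schmidt_has_sum:
  assumes "hilbert_schmidt X" and F: "is_onb F" and F': "is_onb F'"
  obtains s where "((\<lambda>e. (norm (bop_apply X e))\<^sup>2) has_sum s) F"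
    and "((\<lambda>e. (norm (bop_apply (star X) e))\<^sup>2) has_sum s) F'"
proof -
  obtain F0 r where F0: "is_onb F0" and r: "((\<lambda>e. (norm (bop_apply X e))\<^sup>2) has_sum r) F0"
    using assms(1) by (auto simp: hilbert_schmidt_def summable_on_def)
  obtain t where t: "((\<lambda>e. (norm (bop_apply (star X) e))\<^sup>2) has_sum t) F'"
    by (rule hilbert_schmidt_star_le[OF F0 F' r])
  obtain s where s: "((\<lambda>e. (norm (bop_apply X e))\<^sup>2) has_sum s) F" "s \<le> t"
    by (rule hilbert_schmidt_star_le[OF F' F t]) (simp add: star_star)
  obtain t' where t': "((\<lambda>e. (norm (bop_apply (star X) e))\<^sup>2) has_sum t') F'" "t' \<le> s"
    by (rule hilbert_schmidt_star_le[OF F F' s(1)])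
  have "s = t" using has_sum_unique[OF t t'(1)] s(2) t'(2) by simp
  then show ?thesis using that s(1) t by blast
qed

lemma hilbert_schmidt_summable:
  "hilbert_schmidt X \<Longrightarrow> is_onb F \<Longrightarrow> (\<lambda>e. (norm (bop_apply X e))\<^sup>2) summable_on F"
  by (rule hilbert_schmidt_has_sum) (auto dest: has_sum_imp_summable)

lemma hilbert_schmidt_star:
  fixes X :: "'h::chilbert_space bop"
  shows "hilbert_schmidt X \<Longrightarrow> hilbert_schmidt (star X)"
proof -
  assume X: "hilbert_schmidt X"
  then obtain F :: "'h set" where F: "is_onb F" by (auto simp: hilbert_schmidt_def)
  show ?thesis
    by (rule hilbert_schmidt_has_sum[OF X F F])
      (use F in \<open>auto simp: hilbert_schmidt_def dest: has_sum_imp_summable\<close>)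
qed

lemma hilbert_schmidt_times_left: "hilbert_schmidt X \<Longrightarrow> hilbert_schmidt (A * X)"
  unfolding hilbert_schmidt_def
proof (elim exE conjE, intro exI conjI)
  fix F assume X: "(\<lambda>e. (norm (bop_apply X e))\<^sup>2) summable_on F"
  show "(\<lambda>e. (norm (bop_apply (A * X) e))\<^sup>2) summable_on F"
  proof (rule summable_on_comparison_test[OF summable_on_cmult_right[OF X]])
    show "(norm (bop_apply (A * X) e))\<^sup>2 \<le> (norm A)\<^sup>2 * (norm (bop_apply X e))\<^sup>2" for e
      using power_mono[OF norm_bop_apply[of A "bop_apply X e"], of 2]
      by (simp add: bop_apply_times power_mult_distrib)
  qed simp
qed

lemma hilbert_schmidt_times_right: "hilbert_schmidt X \<Longrightarrow> hilbert_schmidt (X * A)"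
  using hilbert_schmidt_star[OF hilbert_schmidt_times_left[OF hilbert_schmidt_star], of X "star A"]
  by (simp add: star_mult star_star)

lemma hilbert_schmidt_add_scaleC:
  fixes X Y :: "'h::chilbert_space bop"
  assumes X: "hilbert_schmidt X" and Y: "hilbert_schmidt Y"
  shows "hilbert_schmidt (X + c *\<^sub>C Y)"
proof -
  obtain F :: "'h set" where F: "is_onb F" using X by (auto simp: hilbert_schmidt_def)
  have "(\<lambda>e. (norm (bop_apply (X + c *\<^sub>C Y) e))\<^sup>2) summable_on F"
  proof (rule summable_on_comparison_test)
    show "(\<lambda>e. 2 * (norm (bop_apply X e))\<^sup>2 + 2 * (norm (bop_apply (c *\<^sub>C id_bop * Y) e))\<^sup>2) summable_on F"
      by (intro summable_on_add summable_on_cmult_right hilbert_schmidt_summable F X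
          hilbert_schmidt_times_left Y)
    show "(norm (bop_apply (X + c *\<^sub>C Y) e))\<^sup>2
        \<le> 2 * (norm (bop_apply X e))\<^sup>2 + 2 * (norm (bop_apply (c *\<^sub>C id_bop * Y) e))\<^sup>2" for e
      using parallelogram[of "bop_apply X e" "c *\<^sub>C bop_apply Y e"]
        zero_le_power2[of "norm (bop_apply X e - c *\<^sub>C bop_apply Y e)"]
      unfolding bop_apply_simps id_bop_times bop_apply_id by linarith
  qed simp
  then show ?thesis using F by (auto simp: hilbert_schmidt_def)
qed

lemma polarization:
  "4 * cinner x y = of_real ((norm (x + 1 *\<^sub>C y))\<^sup>2) + (-1) * of_real ((norm (x + (-1) *\<^sub>C y))\<^sup>2)
    + (- \<i>) * of_real ((norm (x + \<i> *\<^sub>C y))\<^sup>2) + \<i> * of_real ((norm (x + (- \<i>) *\<^sub>C y))\<^sup>2)"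
  unfolding cinner_self[symmetric] cinner_simps by (simp add: complex_eq_iff)

text \<open>The same combination of norms, now with conjugated coefficients as in
  \<open>(X + c Y)\<^sup>* = X\<^sup>* + cnj c Y\<^sup>*\<close>, exchanges the two arguments.\<close>

lemma polarization':
  "4 * cinner y x = of_real ((norm (x + cnj 1 *\<^sub>C y))\<^sup>2) + (-1) * of_real ((norm (x + cnj (-1) *\<^sub>C y))\<^sup>2)
    + (- \<i>) * of_real ((norm (x + cnj \<i> *\<^sub>C y))\<^sup>2) + \<i> * of_real ((norm (x + cnj (- \<i>) *\<^sub>C y))\<^sup>2)"
  unfolding cinner_self[symmetric] cinner_simps by (simp add: complex_eq_iff)

text \<open>In terms of traces: \<open>Tr (X\<^sup>* Y) = Tr (Y X\<^sup>* )\<close>, each side computed in its own basis. By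
  polarization this reduces to the equality of the Hilbert-Schmidt sums of \<open>X + c Y\<close> and its adjoint.\<close>

lemma hilbert_schmidt_inner:
  assumes X: "hilbert_schmidt X" and Y: "hilbert_schmidt Y" and F: "is_onb F" and F': "is_onb F'"
  obtains s where "((\<lambda>e. cinner (bop_apply X e) (bop_apply Y e)) has_sum s) F"
    and "((\<lambda>e. cinner (bop_apply (star Y) e) (bop_apply (star X) e)) has_sum s) F'"
proof -
  have "\<exists>s. ((\<lambda>e. (norm (bop_apply X e + c *\<^sub>C bop_apply Y e))\<^sup>2) has_sum s) F \<and>
      ((\<lambda>e. (norm (bop_apply (star X) e + cnj c *\<^sub>C bop_apply (star Y) e))\<^sup>2) has_sum s) F'" for c
    using hilbert_schmidt_has_sum[OF hilbert_schmidt_add_scaleC[OF X Y] F F', of c]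
    by (auto simp: bop_apply_simps star_add star_scaleC)
  then have "\<exists>q. \<forall>c. ((\<lambda>e. (norm (bop_apply X e + c *\<^sub>C bop_apply Y e))\<^sup>2) has_sum q c) F \<and>
      ((\<lambda>e. (norm (bop_apply (star X) e + cnj c *\<^sub>C bop_apply (star Y) e))\<^sup>2) has_sum q c) F'"
    by (intro choice allI)
  then obtain q where q: "((\<lambda>e. (norm (bop_apply X e + c *\<^sub>C bop_apply Y e))\<^sup>2) has_sum q c) F"
    "((\<lambda>e. (norm (bop_apply (star X) e + cnj c *\<^sub>C bop_apply (star Y) e))\<^sup>2) has_sum q c) F'" for c
    by blast
  define s :: complex where "s = of_real (q 1) + (-1) * of_real (q (-1)) + (- \<i>) * of_real (q \<i>) + \<i> * of_real (q (- \<i>))"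
  have 1: "((\<lambda>e. 4 * cinner (bop_apply X e) (bop_apply Y e)) has_sum s) F"
    unfolding polarization s_def
    by (intro has_sum_add has_sum_cmult_right has_sum_of_real q)
  have 2: "((\<lambda>e. 4 * cinner (bop_apply (star Y) e) (bop_apply (star X) e)) has_sum s) F'"
    unfolding polarization' s_def
    by (intro has_sum_add has_sum_cmult_right has_sum_of_real q)
  show ?thesis
    using that has_sum_cmult_right[OF 1, of "1/4"] has_sum_cmult_right[OF 2, of "1/4"] by simp
qed

text \<open>For \<open>M = B\<^sup>* B\<close> and \<open>N = W\<^sup>* W\<close> with Hilbert-Schmidt entries of \<open>W\<close>, cyclicity turns the trace
  of \<open>M N\<close> on \<open>\<H>\<^sup>k\<close> into that of \<open>(B W\<^sup>* ) (B W\<^sup>* )\<^sup>*\<close>, a sum of squared norms.\<close>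

lemma trace_mult_positive_matrices:
  fixes B W :: "'h::chilbert_space bop^'k^'k"
  assumes W: "\<And>m i. hilbert_schmidt (W $ m $ i)" and F: "is_onb F"
  shows "0 \<le> (\<Sum>i\<in>UNIV. \<Sum>j\<in>UNIV. \<Sum>\<^sub>\<infinity>f\<in>F. cinner f
    (bop_apply (mat_mult (mat_star B) B $ i $ j * mat_mult (mat_star W) W $ j $ i) f))"
proof -
  \<comment> \<open>Simplification with this equation moves all factors into the second argument.\<close>
  have to_right: "cinner (bop_apply A x) y = cinner x (bop_apply (star A) y)" for A :: "'h bop" and x y
    by (rule cinner_star_right[symmetric])
  define Z where "Z l m i = B $ l $ i * star (W $ m $ i)" for l m i
  have ex: "\<exists>s. ((\<lambda>f. cinner f (bop_apply (star (B $ l $ i) * B $ l $ j * (star (W $ m $ j) * W $ m $ i)) f)) has_sum s) F \<and>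
      ((\<lambda>f. cinner (bop_apply (Z l m i) f) (bop_apply (Z l m j) f)) has_sum s) F" for i j l m
  proof -
    define X where "X = W $ m $ j * star (B $ l $ j) * B $ l $ i"
    have "hilbert_schmidt X"
      unfolding X_def by (intro hilbert_schmidt_times_right W)
    then obtain s where s: "((\<lambda>f. cinner (bop_apply X f) (bop_apply (W $ m $ i) f)) has_sum s) F"
      "((\<lambda>f. cinner (bop_apply (star (W $ m $ i)) f) (bop_apply (star X) f)) has_sum s) F"
      using hilbert_schmidt_inner[OF _ W F F] by blast
    show ?thesis
    proof (intro exI conjI)
      show "((\<lambda>f. cinner f (bop_apply (star (B $ l $ i) * B $ l $ j * (star (W $ m $ j) * W $ m $ i)) f)) has_sum s) F"
        using s(1) by (simp add: X_def bop_apply_times star_star to_right)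
      show "((\<lambda>f. cinner (bop_apply (Z l m i) f) (bop_apply (Z l m j) f)) has_sum s) F"
        using s(2) by (simp add: X_def Z_def bop_apply_times star_mult star_star to_right)
    qed
  qed
  define s where "s i j l m = (\<Sum>\<^sub>\<infinity>f\<in>F. cinner (bop_apply (Z l m i) f) (bop_apply (Z l m j) f))" for i j l m
  have s1: "((\<lambda>f. cinner f (bop_apply (star (B $ l $ i) * B $ l $ j * (star (W $ m $ j) * W $ m $ i)) f))
      has_sum s i j l m) F"
    and s2: "((\<lambda>f. cinner (bop_apply (Z l m i) f) (bop_apply (Z l m j) f)) has_sum s i j l m) F"
    for i j l m using ex[of l i j m] infsumI unfolding s_def by fastforce+
  have tr: "(\<Sum>\<^sub>\<infinity>f\<in>F. cinner f
      (bop_apply (mat_mult (mat_star B) B $ i $ j * mat_mult (mat_star W) W $ j $ i) f))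
      = (\<Sum>l\<in>UNIV. \<Sum>m\<in>UNIV. s i j l m)" for i j
  proof (rule infsumI)
    have "mat_mult (mat_star B) B $ i $ j * mat_mult (mat_star W) W $ j $ i
        = (\<Sum>l\<in>UNIV. \<Sum>m\<in>UNIV. star (B $ l $ i) * B $ l $ j * (star (W $ m $ j) * W $ m $ i))"
      by (simp add: mat_mult_star_nth sum_product)
    then show "((\<lambda>f. cinner f (bop_apply (mat_mult (mat_star B) B $ i $ j * mat_mult (mat_star W) W $ j $ i) f))
        has_sum (\<Sum>l\<in>UNIV. \<Sum>m\<in>UNIV. s i j l m)) F"
      by (simp only: bop_apply_sum_left cinner_sum_right) (intro has_sum_finite_sum s1)
  qed
  have "((\<lambda>f. \<Sum>i\<in>UNIV. \<Sum>j\<in>UNIV. \<Sum>l\<in>UNIV. \<Sum>m\<in>UNIV. cinner (bop_apply (Z l m i) f) (bop_apply (Z l m j) f))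
      has_sum (\<Sum>i\<in>UNIV. \<Sum>j\<in>UNIV. \<Sum>l\<in>UNIV. \<Sum>m\<in>UNIV. s i j l m)) F"
    by (intro has_sum_finite_sum s2)
  moreover have "0 \<le> (\<Sum>i\<in>UNIV. \<Sum>j\<in>UNIV. \<Sum>l\<in>UNIV. \<Sum>m\<in>UNIV.
      cinner (bop_apply (Z l m i) f) (bop_apply (Z l m j) f))" for f
  proof -
    have "(\<Sum>i\<in>UNIV. \<Sum>j\<in>UNIV. \<Sum>l\<in>UNIV. \<Sum>m\<in>UNIV. cinner (bop_apply (Z l m i) f) (bop_apply (Z l m j) f))
        = (\<Sum>l\<in>UNIV. \<Sum>m\<in>UNIV. \<Sum>i\<in>UNIV. \<Sum>j\<in>UNIV. cinner (bop_apply (Z l m i) f) (bop_apply (Z l m j) f))"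
      by (rule sum_swap_pairs)
    also have "\<dots> = (\<Sum>l\<in>UNIV. \<Sum>m\<in>UNIV. cinner (\<Sum>i\<in>UNIV. bop_apply (Z l m i) f) (\<Sum>j\<in>UNIV. bop_apply (Z l m j) f))"
      by (simp only: cinner_sum_left) (simp only: cinner_sum_right)
    also have "0 \<le> \<dots>" by (intro sum_nonneg cinner_self_ge_0)
    finally show ?thesis .
  qed
  ultimately have "0 \<le> (\<Sum>i\<in>UNIV. \<Sum>j\<in>UNIV. \<Sum>l\<in>UNIV. \<Sum>m\<in>UNIV. s i j l m)"
    by (rule has_sum_nonneg_complex)
  then show ?thesis by (simp only: tr)
qed

text \<open>Uniqueness of the square root identifies the absolute value of a positive operator with the
  operator itself, and the square root \<open>R\<close> of \<open>A\<close> carries summability from one basis to another, since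
  \<open>\<langle>e, A e\<rangle> = \<parallel>R e\<parallel>\<^sup>2\<close>.\<close>

lemma positive_trace_class_summable:
  assumes A: "positive_op A" and "trace_class A" and F: "is_onb F"
  shows "(\<lambda>e. cinner e (bop_apply A e)) summable_on F"
proof -
  obtain P E where P: "positive_op P" "P * P = star A * A" and E: "is_onb E"
    and sP: "(\<lambda>e. cinner e (bop_apply P e)) summable_on E"
    using assms(2) unfolding trace_class_def by blast
  have "P = A"
    by (rule positive_sqrt_unique[OF P(1) A]) (simp add: P(2) positive_op_star[OF A])
  obtain R where R: "positive_op R" "R * R = A" by (rule positive_sqrt_exists[OF A])
  have form: "cinner e (bop_apply A e) = of_real ((norm (bop_apply R e))\<^sup>2)" for e
    unfolding cinner_self[symmetric] selfadjoint_cinner[OF positive_op_star[OF R(1)]]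
    by (simp only: R(2)[symmetric] bop_apply_times)
  have "(\<lambda>e. (norm (bop_apply R e))\<^sup>2) summable_on E"
    using summable_on_Re[OF sP] by (simp add: \<open>P = A\<close> form)
  then have "hilbert_schmidt R" using E by (auto simp: hilbert_schmidt_def)
  then have "(\<lambda>e. (norm (bop_apply R e))\<^sup>2) summable_on F" using F by (rule hilbert_schmidt_summable)
  then show ?thesis unfolding form by (rule summable_on_of_real)
qed

section \<open>The conjugation of an orthonormal basis and the transpose\<close>

text \<open>The antiunitary involution that fixes every vector of \<open>E\<close>. The defining property determines it
  when \<open>E\<close> is an orthonormal basis.\<close>

definition conj_on :: "'h::chilbert_space set \<Rightarrow> 'h \<Rightarrow> 'h"
  where "conj_on E x = (SOME z. \<forall>e\<in>E. cinner e z = cnj (cinner e x))"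

context
  fixes E :: "'h::chilbert_space set"
  assumes E: "is_onb E"
begin

lemma cinner_basis_conj_on: "e \<in> E \<Longrightarrow> cinner e (conj_on E x) = cnj (cinner e x)"
proof -
  have "\<exists>z. \<forall>e\<in>E. cinner e z = cnj (cinner e x)"
  proof (rule riesz_fischer[OF E, of "\<lambda>e. cnj (cinner e x)" "(norm x)\<^sup>2"])
    show "(\<Sum>g\<in>G. (cmod (cnj (cinner g x)))\<^sup>2) \<le> (norm x)\<^sup>2" if "finite G" "G \<subseteq> E" for G
      using bessel[OF E that] by simp
  qed blast
  then show "e \<in> E \<Longrightarrow> cinner e (conj_on E x) = cnj (cinner e x)"
    unfolding conj_on_def by (rule someI2_ex) blast
qed

lemma conj_on_add: "conj_on E (x + y) = conj_on E x + conj_on E y"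
  by (rule onb_eqI[OF E]) (simp add: cinner_basis_conj_on cinner_add_right)

lemma conj_on_scaleC: "conj_on E (c *\<^sub>C x) = cnj c *\<^sub>C conj_on E x"
  by (rule onb_eqI[OF E]) (simp add: cinner_basis_conj_on cinner_scaleC_right)

lemma conj_on_scaleR: "conj_on E (r *\<^sub>R x) = r *\<^sub>R conj_on E x"
  using conj_on_scaleC[of "of_real r" x] by (simp add: scaleC_of_real)

lemma conj_on_conj_on: "conj_on E (conj_on E x) = x"
  by (rule onb_eqI[OF E]) (simp add: cinner_basis_conj_on)

lemma conj_on_basis: "e \<in> E \<Longrightarrow> conj_on E e = e"
  by (rule onb_eqI[OF E]) (simp add: cinner_basis_conj_on onb_cinner[OF E])

lemma cinner_conj_on: "cinner (conj_on E x) (conj_on E y) = cinner y x"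
proof (rule has_sum_unique)
  show "((\<lambda>e. cinner (conj_on E x) e * cinner e (conj_on E y)) has_sum
      cinner (conj_on E x) (conj_on E y)) E"
    by (rule parseval[OF E])
  have "cinner y e * cinner e x = cinner (conj_on E x) e * cinner e (conj_on E y)" if "e \<in> E" for e
    using that
    by (simp add: cinner_basis_conj_on cinner_commute[of "conj_on E x" e] cinner_commute[of y e])
  then show "((\<lambda>e. cinner (conj_on E x) e * cinner e (conj_on E y)) has_sum cinner y x) E"
    using parseval[OF E, of y x] by (simp cong: has_sum_cong)
qed

lemma norm_conj_on: "norm (conj_on E x) = norm x"
proof -
  have "(norm (conj_on E x))\<^sup>2 = (norm x)\<^sup>2" by (simp add: norm_sq_cinner cinner_conj_on)
  then show ?thesis by simp
qed

text \<open>The transpose of \<open>A\<close> is \<open>J A\<^sup>* J\<close> for the conjugation \<open>J\<close>: both have the same matrix with respect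
  to \<open>E\<close>, and this matrix determines a bounded operator.\<close>

lemma cinner_op_transpose:
  "cinner x (bop_apply (op_transpose E A) y) = cinner (conj_on E y) (bop_apply A (conj_on E x))"
proof -
  have "bounded_clinear (\<lambda>y. conj_on E (bop_apply (star A) (conj_on E y)))"
    unfolding bounded_clinear_def
  proof (intro conjI allI)
    show "bounded_linear (\<lambda>y. conj_on E (bop_apply (star A) (conj_on E y)))"
    proof (rule bounded_linear_intro[where K="norm (star A)"])
      show "norm (conj_on E (bop_apply (star A) (conj_on E y))) \<le> norm y * norm (star A)" for y
        using norm_bop_apply[of "star A" "conj_on E y"] by (simp add: norm_conj_on mult.commute)
    qed (simp_all add: conj_on_add conj_on_scaleR bop_apply_simps)
  qed (simp add: conj_on_scaleC bop_apply_simps)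
  then have B: "bop_apply (bop_of (\<lambda>y. conj_on E (bop_apply (star A) (conj_on E y)))) y
      = conj_on E (bop_apply (star A) (conj_on E y))" for y
    by (simp add: bop_apply_bop_of)
  define B where "B = bop_of (\<lambda>y. conj_on E (bop_apply (star A) (conj_on E y)))"
  have form: "cinner x (bop_apply B y) = cinner (conj_on E y) (bop_apply A (conj_on E x))" for x y
    using cinner_conj_on[of "conj_on E x" "bop_apply (star A) (conj_on E y)"]
    by (simp add: B_def B conj_on_conj_on cinner_star_left)
  have "op_transpose E A = B"
    unfolding op_transpose_def
  proof (rule the_equality)
    show "\<forall>e\<in>E. \<forall>f\<in>E. cinner e (bop_apply B f) = cinner f (bop_apply A e)"
      by (simp add: form conj_on_basis)
    fix C assume C: "\<forall>e\<in>E. \<forall>f\<in>E. cinner e (bop_apply C f) = cinner f (bop_apply A e)"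
    have eq: "bop_apply C f = bop_apply B f" if "f \<in> E" for f
      by (rule onb_eqI[OF E]) (use C that in \<open>simp add: form conj_on_basis\<close>)
    have "bop_apply (star C) x = bop_apply (star B) x" for x
    proof (rule onb_eqI[OF E])
      fix f assume "f \<in> E"
      then show "cinner f (bop_apply (star C) x) = cinner f (bop_apply (star B) x)"
        by (simp add: cinner_star_right eq)
    qed
    then show "C = B" by (metis bop_eqI star_star)
  qed
  then show ?thesis by (simp add: form)
qed

end

section \<open>Rank one operators\<close>

definition rank_one :: "'h::chilbert_space \<Rightarrow> 'h \<Rightarrow> 'h bop"
  where "rank_one u v = bop_of (\<lambda>x. cinner v x *\<^sub>C u)"

lemma bop_apply_rank_one: "bop_apply (rank_one u v) x = cinner v x *\<^sub>C u"
proof -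
  have "bounded_clinear (\<lambda>x. cinner v x *\<^sub>C u)"
    unfolding bounded_clinear_def
  proof (intro conjI allI)
    show "bounded_linear (\<lambda>x. cinner v x *\<^sub>C u)"
    proof (rule bounded_linear_intro[where K="norm v * norm u"])
      show "norm (cinner v x *\<^sub>C u) \<le> norm x * (norm v * norm u)" for x
        using mult_right_mono[OF cinner_cauchy_schwarz[of v x], of "norm u"]
        by (simp add: norm_scaleC mult_ac)
      show "cinner v (r *\<^sub>R x) *\<^sub>C u = r *\<^sub>R cinner v x *\<^sub>C u" for r x
        by (simp only: cinner_scaleR_right scaleC_scaleC[symmetric] scaleC_of_real)
    qed (simp add: cinner_add_right scaleC_add_left)
  qed (simp add: cinner_scaleC_right scaleC_scaleC)
  then show ?thesis unfolding rank_one_def by (simp add: bop_apply_bop_of)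
qed

lemma trace_class_rank_one:
  fixes E :: "'h::chilbert_space set"
  assumes E: "is_onb E"
  shows "trace_class (rank_one u v :: 'h bop)"
proof -
  \<comment> \<open>For \<open>v = 0\<close> the quotient is \<open>0\<close> by convention, and so are both operators.\<close>
  define c where "c = norm u / norm v"
  define P where "P = c *\<^sub>R rank_one v v"
  have form: "cinner x (bop_apply P x) = of_real (c * (cmod (cinner x v))\<^sup>2)" for x
    unfolding P_def bop_apply_simps bop_apply_rank_one cinner_simps mult.commute[of "cinner v x"]
      cinner_mult_commute by (simp add: cmod_cinner_commute[of v])
  show ?thesis
    unfolding trace_class_def
  proof (intro exI conjI)
    show "positive_op P" by (simp add: positive_op_def form less_eq_complex_def c_def)
    show "P * P = star (rank_one u v) * rank_one u v"
    proof (rule bop_eqI_cinner_right)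
      fix x y
      have "cinner x (bop_apply (P * P) y) = of_real ((c * norm v)\<^sup>2) * (cinner v y * cinner x v)"
        by (simp add: P_def bop_apply_simps bop_apply_rank_one cinner_simps cinner_self power2_eq_square)
      also have "\<dots> = of_real ((norm u)\<^sup>2) * (cinner v y * cinner x v)"
        by (cases "v = 0") (simp_all add: c_def)
      also have "\<dots> = cinner x (bop_apply (star (rank_one u v) * rank_one u v) y)"
        using cinner_commute[of x v]
        by (simp add: bop_apply_simps bop_apply_rank_one cinner_star_right cinner_simps cinner_self)
      finally show "cinner x (bop_apply (P * P) y)
          = cinner x (bop_apply (star (rank_one u v) * rank_one u v) y)" .
    qed
    show "(\<lambda>e. cinner e (bop_apply P e)) summable_on E"
      unfolding form
      by (intro summable_on_of_real summable_on_cmult_right has_sum_imp_summable[OF parseval_norm[OF E]])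
  qed (rule E)
qed

lemma is_onb_some:
  fixes E :: "'h::chilbert_space set"
  assumes "is_onb E"
  shows "is_onb (SOME E :: 'h set. is_onb E)"
  using assms by (rule someI)

lemma op_trace_times_rank_one:
  fixes A :: "'h::chilbert_space bop" and E :: "'h set"
  assumes E: "is_onb E"
  shows "op_trace (A * rank_one u v) = cinner v (bop_apply A u)"
  unfolding op_trace_def
proof (rule infsumI)
  show "((\<lambda>e. cinner e (bop_apply (A * rank_one u v) e)) has_sum cinner v (bop_apply A u))
      (SOME E. is_onb E)"
    using parseval[OF is_onb_some[OF E], of v "bop_apply A u"]
    by (simp add: bop_apply_simps bop_apply_rank_one cinner_scaleC_right)
qed

lemma op_transpose_rank_one:
  assumes E: "is_onb E"
  shows "op_transpose E (rank_one (conj_on E u) (conj_on E v)) = rank_one v u"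
  by (rule bop_eqI_cinner_right)
    (simp add: cinner_op_transpose[OF E] bop_apply_rank_one cinner_scaleC_right cinner_conj_on[OF E]
      mult.commute)

lemma predual_mat_positive_rank_one:
  fixes \<eta> :: "'h::chilbert_space^'k"
  assumes E: "is_onb (E :: 'h set)"
  shows "predual_mat_positive (\<chi> i j. rank_one (\<eta> $ i) (\<eta> $ j))"
  unfolding predual_mat_positive_def
proof (intro conjI allI)
  show "trace_class ((\<chi> i j. rank_one (\<eta> $ i) (\<eta> $ j)) $ i $ j)" for i j
    by (simp add: trace_class_rank_one[OF E])
  fix \<xi> :: "'h^'k"
  have "(\<Sum>i\<in>UNIV. \<Sum>j\<in>UNIV. cinner (\<xi> $ i) (bop_apply ((\<chi> i j. rank_one (\<eta> $ i) (\<eta> $ j)) $ i $ j) (\<xi> $ j)))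
      = cinner \<xi> \<eta> * cinner \<eta> \<xi>"
    by (simp add: bop_apply_rank_one cinner_scaleC_right cinner_vec_def sum_product mult.commute[of "cinner (\<eta> $ _) _"])
  then show "0 \<le> (\<Sum>i\<in>UNIV. \<Sum>j\<in>UNIV. cinner (\<xi> $ i) (bop_apply ((\<chi> i j. rank_one (\<eta> $ i) (\<eta> $ j)) $ i $ j) (\<xi> $ j)))"
    by (simp only: cinner_mult_commute) (simp add: less_eq_complex_def)
qed

section \<open>The duality\<close>

text \<open>Entrywise transposition followed by transposition of the matrix preserves positivity, because
  its quadratic form at \<open>\<xi>\<close> is that of \<open>R\<close> at the conjugated vector \<open>\<eta>\<close>. The factor \<open>W\<close> is Hilbert-Schmidt
  because \<open>\<Sum>\<^sub>m \<parallel>W\<^sub>m\<^sub>i e\<parallel>\<^sup>2 = \<langle>e, R\<^sub>i\<^sub>i\<^sup>t e\<rangle> = \<langle>e, R\<^sub>i\<^sub>i e\<rangle>\<close> for \<open>e\<close> in the basis.\<close>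

lemma transposed_predual_matrix:
  fixes R :: "'h::chilbert_space bop^'k^'k"
  assumes E: "is_onb E" and R: "predual_mat_positive R"
  obtains W where "\<And>i j. op_transpose E (R $ i $ j) = mat_mult (mat_star W) W $ j $ i"
    and "\<And>m i. hilbert_schmidt (W $ m $ i)"
proof -
  define N where "N = (\<chi> i j. op_transpose E (R $ j $ i))"
  have "mat_positive N"
    unfolding mat_positive_iff
  proof
    fix \<xi> :: "'h^'k"
    define \<eta> where "\<eta> = (\<chi> i. conj_on E (\<xi> $ i))"
    have "(\<Sum>i\<in>UNIV. \<Sum>j\<in>UNIV. cinner (\<xi> $ i) (bop_apply (N $ i $ j) (\<xi> $ j)))
        = (\<Sum>i\<in>UNIV. \<Sum>j\<in>UNIV. cinner (\<eta> $ j) (bop_apply (R $ j $ i) (\<eta> $ i)))"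
      by (simp add: N_def \<eta>_def cinner_op_transpose[OF E])
    also have "\<dots> = (\<Sum>j\<in>UNIV. \<Sum>i\<in>UNIV. cinner (\<eta> $ j) (bop_apply (R $ j $ i) (\<eta> $ i)))"
      by (rule sum.swap)
    also have "0 \<le> \<dots>" using R unfolding predual_mat_positive_def by blast
    finally show "0 \<le> (\<Sum>i\<in>UNIV. \<Sum>j\<in>UNIV. cinner (\<xi> $ i) (bop_apply (N $ i $ j) (\<xi> $ j)))" .
  qed
  then obtain W where W: "N = mat_mult (mat_star W) W" unfolding mat_positive_def by blast
  have "hilbert_schmidt (W $ m $ i)" for m i
  proof -
    have "positive_op (R $ i $ i)"
      unfolding positive_op_def
    proof
      fix x
      have "0 \<le> cinner (axis i x) (bop_apply (op_of_mat R) (axis i x))"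
        using R unfolding predual_mat_positive_def cinner_op_of_mat by blast
      also have "\<dots> = cinner x (\<Sum>j\<in>UNIV. bop_apply (R $ i $ j) (axis i x $ j))"
        by (simp add: cinner_axis_left bop_apply_op_of_mat)
      also have "(\<Sum>j\<in>UNIV. bop_apply (R $ i $ j) (axis i x $ j))
          = (\<Sum>j\<in>UNIV. if j = i then bop_apply (R $ i $ i) x else 0)"
        by (intro sum.cong refl) (auto simp: axis_def bop_apply_simps)
      finally show "0 \<le> cinner x (bop_apply (R $ i $ i) x)" by simp
    qed
    then have "(\<lambda>e. cinner e (bop_apply (R $ i $ i) e)) summable_on E"
      using R E unfolding predual_mat_positive_def by (intro positive_trace_class_summable) auto
    then have "(\<lambda>e. Re (cinner e (bop_apply (R $ i $ i) e))) summable_on E" by (rule summable_on_Re)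
    then have "(\<lambda>e. (norm (bop_apply (W $ m $ i) e))\<^sup>2) summable_on E"
    proof (rule summable_on_comparison_test)
      fix e assume e: "e \<in> E"
      have "cinner e (bop_apply (R $ i $ i) e) = cinner e (bop_apply (N $ i $ i) e)"
        using e by (simp add: N_def cinner_op_transpose[OF E] conj_on_basis[OF E])
      also have "\<dots> = of_real (\<Sum>m\<in>UNIV. (norm (bop_apply (W $ m $ i) e))\<^sup>2)"
        by (simp add: W mat_mult_star_nth bop_apply_sum_left bop_apply_times cinner_sum_right
            cinner_star_right cinner_self)
      finally have "Re (cinner e (bop_apply (R $ i $ i) e)) = (\<Sum>m\<in>UNIV. (norm (bop_apply (W $ m $ i) e))\<^sup>2)"
        by simp
      then show "(norm (bop_apply (W $ m $ i) e))\<^sup>2 \<le> Re (cinner e (bop_apply (R $ i $ i) e))"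
        using member_le_sum[of m UNIV "\<lambda>m. (norm (bop_apply (W $ m $ i) e))\<^sup>2"] by simp
    qed simp
    then show ?thesis using E by (auto simp: hilbert_schmidt_def)
  qed
  moreover have "op_transpose E (R $ i $ j) = mat_mult (mat_star W) W $ j $ i" for i j
    by (simp add: W[symmetric] N_def)
  ultimately show ?thesis using that by blast
qed

theorem mainTheorem3:
  fixes T :: "'a::cstar_algebra \<Rightarrow> 'h::chilbert_space bop" and E :: "'h set"
  assumes "is_onb E" and "bounded_clinear T"
  shows "k_positive TYPE('k::finite) T \<longleftrightarrow>
    (\<forall>(p\<^sub>0::nat) (a :: nat \<Rightarrow> 'a^'k^'k) (\<rho> :: nat \<Rightarrow> 'h bop^'k^'k).
      (\<forall>p\<in>{1..p\<^sub>0}. mat_positive (a p) \<and> predual_mat_positive (\<rho> p)) \<longrightarrow>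
      0 \<le> (\<Sum>p = 1..p\<^sub>0. \<Sum>i\<in>UNIV. \<Sum>j\<in>UNIV.
             op_trace (T (a p $ i $ j) * op_transpose E (\<rho> p $ i $ j))))"
  (is "_ \<longleftrightarrow> ?R")
proof
  assume T: "k_positive TYPE('k) T"
  show ?R
  proof (intro allI impI, rule sum_nonneg)
    fix p\<^sub>0 p :: nat and a :: "nat \<Rightarrow> 'a^'k^'k" and \<rho> :: "nat \<Rightarrow> 'h bop^'k^'k"
    assume "\<forall>p\<in>{1..p\<^sub>0}. mat_positive (a p) \<and> predual_mat_positive (\<rho> p)" and "p \<in> {1..p\<^sub>0}"
    then have a: "mat_positive (a p)" and \<rho>: "predual_mat_positive (\<rho> p)" by auto
    obtain B where B: "map_matrix T (a p) = mat_mult (mat_star B) B"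
      using T a unfolding k_positive_def mat_positive_def[of "map_matrix T _"] by blast
    have Tij: "T (a p $ i $ j) = mat_mult (mat_star B) B $ i $ j" for i j
      by (simp add: B[symmetric])
    obtain W where W: "\<And>i j. op_transpose E (\<rho> p $ i $ j) = mat_mult (mat_star W) W $ j $ i"
      and hs: "\<And>m i. hilbert_schmidt (W $ m $ i)"
      using transposed_predual_matrix[OF assms(1) \<rho>] by blast
    show "0 \<le> (\<Sum>i\<in>UNIV. \<Sum>j\<in>UNIV. op_trace (T (a p $ i $ j) * op_transpose E (\<rho> p $ i $ j)))"
      unfolding Tij W op_trace_def
      by (rule trace_mult_positive_matrices[OF hs is_onb_some[OF assms(1)]])
  qed
next
  assume R: ?R
  show "k_positive TYPE('k) T"
    unfolding k_positive_def mat_positive_iff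
  proof (intro allI impI)
    fix A :: "'a^'k^'k" and \<xi> :: "'h^'k"
    assume A: "mat_positive A"
    \<comment> \<open>Conjugated vectors, because transposition turns \<open>|J u\<rangle>\<langle>J v|\<close> into \<open>|v\<rangle>\<langle>u|\<close>.\<close>
    define \<rho> :: "'h bop^'k^'k"
      where "\<rho> = (\<chi> i j. rank_one ((\<chi> i. conj_on E (\<xi> $ i)) $ i) ((\<chi> i. conj_on E (\<xi> $ i)) $ j))"
    have "predual_mat_positive \<rho>"
      unfolding \<rho>_def by (rule predual_mat_positive_rank_one[OF assms(1)])
    then have "0 \<le> (\<Sum>p = 1..1::nat. \<Sum>i\<in>UNIV. \<Sum>j\<in>UNIV.
        op_trace (T (A $ i $ j) * op_transpose E (\<rho> $ i $ j)))"
      using R[rule_format, of 1 "\<lambda>_. A" "\<lambda>_. \<rho>"] A by simp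
    also have "\<dots> = (\<Sum>i\<in>UNIV. \<Sum>j\<in>UNIV. cinner (\<xi> $ i) (bop_apply (T (A $ i $ j)) (\<xi> $ j)))"
      by (simp add: \<rho>_def op_transpose_rank_one[OF assms(1)] op_trace_times_rank_one[OF assms(1)])
    finally show "0 \<le> (\<Sum>i\<in>UNIV. \<Sum>j\<in>UNIV.
        cinner (\<xi> $ i) (bop_apply (map_matrix T A $ i $ j) (\<xi> $ j)))"
      by simp
  qed
qed

end
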